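(* Let $\Gamma$ be a finite simplicial graph with non-empty vertex set $V(\Gamma)$, let $\{G_v\mid v\in V(\Gamma)\}$ be a collection of non-trivial groups, and let $G_\Gamma$ be the associated graph product. Let $\Delta$ denote the subgraph of $\Gamma$ spanned by all vertices $v\in V(\Gamma)$ such that $st(v)=V(\Gamma)$. If the vertex groups $G_v$, $v\in V(\Delta)$, are abelian, then $G_\Gamma$ is semicomplete if and only if the graph product $G_{\langle V(\Gamma)-V(\Delta)\rangle}$ is semicomplete, where $\langle V(\Gamma)-V(\Delta)\rangle$ is the subgraph of $\Gamma$ spanned by the vertex set $V(\Gamma)-V(\Delta)$ (with the same vertex groups $G_v$, $v\in V(\Gamma)-V(\Delta)$).
   Context: Graphs are finite, without loops and multiple edges. For a graph $\Gamma$ with vertex set $V(\Gamma)$ and edge set $E(\Gamma)$ (a set of 2-element subsets of $V(\Gamma)$), and non-trivial groups $G_v$ ($v\in V(\Gamma)$), the graph product $G_\Gamma$ is the quotient of the free product $\ast_{v\in V(\Gamma)} G_v$ by the normal closure of all commutators $[g,h]$ with $g\in G_v$, $h\in G_w$, $\{v,w\}\in E(\Gamma)$. The graph product over the empty graph is the trivial group. The subgraph spanned by a subset $V'\subseteq V(\Gamma)$ is the induced subgraph, with vertex set $V'$ and all edges of $\Gamma$ between vertices of $V'$. For $v\in V(\Gamma)$, the star of $v$ is $st(v)=\{v\}\cup\{w\in V(\Gamma)\mid \{v,w\}\in E(\Gamma)\}$. For a group $G$ let $G^{ab}=G/G'$ be its abelianization and $\Phi\colon \mathrm{Aut}(G)\to\mathrm{Aut}(G^{ab})$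 the natural homomorphism induced by the abelianization map. Write $\mathrm{IA}(G)=\ker(\Phi)$; always $\mathrm{Inn}(G)\subseteq \mathrm{IA}(G)$. The group $G$ is called semicomplete if $\mathrm{IA}(G)=\mathrm{Inn}(G)$. *)

theory Defs
  imports "HOL-Algebra.Algebra"
begin

section \<open>Finite simple graphs\<close>

record 'v sgraph =
  verts :: "'v set"
  edges :: "'v set set"

definition simple_graph :: "'v sgraph \<Rightarrow> bool" where
  "simple_graph \<Gamma> \<longleftrightarrow> finite (verts \<Gamma>) \<and> (\<forall>e\<in>edges \<Gamma>. e \<subseteq> verts \<Gamma> \<and> card e = 2)"

definition star :: "'v sgraph \<Rightarrow> 'v \<Rightarrow> 'v set" where
  "star \<Gamma> v = {v} \<union> {w \<in> verts \<Gamma>. {v, w} \<in> edges \<Gamma>}"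

definition spanned :: "'v sgraph \<Rightarrow> 'v set \<Rightarrow> 'v sgraph" where
  "spanned \<Gamma> W = \<lparr>verts = W, edges = {e \<in> edges \<Gamma>. e \<subseteq> W}\<rparr>"

section \<open>Free products\<close>

text \<open>
  Elements of the free product of the groups \<open>G i\<close>, \<open>i \<in> I\<close>, are classes of words in the
  disjoint union of the carriers, modulo the smallest congruence for concatenation which deletes
  identity letters and multiplies adjacent letters from the same factor.
\<close>

definition fp_words :: "'i set \<Rightarrow> ('i \<Rightarrow> ('a, 'b) monoid_scheme) \<Rightarrow> ('i \<times> 'a) list set" where
  "fp_words I G = lists (SIGMA i:I. carrier (G i))"

inductive_set fp_rel :: "'i set \<Rightarrow> ('i \<Rightarrow> ('a, 'b) monoid_scheme) \<Rightarrow> (('i \<times> 'a) list \<times> ('i \<times> 'a) list) set"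
  for I G where
  one: "i \<in> I \<Longrightarrow> ([(i, \<one>\<^bsub>G i\<^esub>)], []) \<in> fp_rel I G"
| mult: "\<lbrakk>i \<in> I; a \<in> carrier (G i); b \<in> carrier (G i)\<rbrakk>
    \<Longrightarrow> ([(i, a), (i, b)], [(i, a \<otimes>\<^bsub>G i\<^esub> b)]) \<in> fp_rel I G"
| refl: "u \<in> fp_words I G \<Longrightarrow> (u, u) \<in> fp_rel I G"
| sym: "(u, v) \<in> fp_rel I G \<Longrightarrow> (v, u) \<in> fp_rel I G"
| trans: "\<lbrakk>(u, v) \<in> fp_rel I G; (v, w) \<in> fp_rel I G\<rbrakk> \<Longrightarrow> (u, w) \<in> fp_rel I G"
| append: "\<lbrakk>(u, u') \<in> fp_rel I G; (v, v') \<in> fp_rel I G\<rbrakk> \<Longrightarrow> (u @ v, u' @ v') \<in> fp_rel I G"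

definition free_product ::
    "'i set \<Rightarrow> ('i \<Rightarrow> ('a, 'b) monoid_scheme) \<Rightarrow> ('i \<times> 'a) list set monoid" where
  "free_product I G =
    \<lparr>carrier = fp_words I G // fp_rel I G,
     monoid.mult = \<lambda>A B. \<Union>u\<in>A. \<Union>v\<in>B. fp_rel I G `` {u @ v},
     one = fp_rel I G `` {[]}\<rparr>"

definition fp_incl ::
    "'i set \<Rightarrow> ('i \<Rightarrow> ('a, 'b) monoid_scheme) \<Rightarrow> 'i \<Rightarrow> 'a \<Rightarrow> ('i \<times> 'a) list set" where
  "fp_incl I G i a = fp_rel I G `` {[(i, a)]}"

lemma fp_words_append: "\<lbrakk>u \<in> fp_words I G; v \<in> fp_words I G\<rbrakk> \<Longrightarrow> u @ v \<in> fp_words I G"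
  by (simp add: fp_words_def)

lemma fp_rel_words:
  assumes "\<And>i. i \<in> I \<Longrightarrow> group (G i)" and "(u, v) \<in> fp_rel I G"
  shows "u \<in> fp_words I G \<and> v \<in> fp_words I G"
  using assms(2)
  by induction (auto simp: fp_words_def intro: assms(1) group.is_monoid monoid.one_closed monoid.m_closed)

lemma equiv_fp_rel:
  assumes "\<And>i. i \<in> I \<Longrightarrow> group (G i)"
  shows "equiv (fp_words I G) (fp_rel I G)"
proof (rule equivI)
  show "fp_rel I G \<subseteq> fp_words I G \<times> fp_words I G"
    using fp_rel_words[OF assms] by fastforce
  show "refl_on (fp_words I G) (fp_rel I G)"
    by (auto simp: refl_on_def intro: fp_rel.refl)
  show "Relation.sym (fp_rel I G)" by (auto simp: sym_on_def intro: fp_rel.sym)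
  show "Relation.trans (fp_rel I G)" by (rule transI) (rule fp_rel.trans)
qed

lemma fp_mult_class:
  assumes G: "\<And>i. i \<in> I \<Longrightarrow> group (G i)" and "u \<in> fp_words I G" "v \<in> fp_words I G"
  shows "fp_rel I G `` {u} \<otimes>\<^bsub>free_product I G\<^esub> fp_rel I G `` {v} = fp_rel I G `` {u @ v}"
proof -
  note E = equiv_fp_rel[of I G, OF G]
  have "congruent2 (fp_rel I G) (fp_rel I G) (\<lambda>u v. fp_rel I G `` {u @ v})"
    by (auto simp: congruent2_def intro!: equiv_class_eq[OF E] fp_rel.append)
  then show ?thesis
    using UN_equiv_class2[OF E E _ assms(2,3)] by (simp add: free_product_def)
qed

lemma fp_carrier_cases:
  assumes "x \<in> carrier (free_product I G)"
  obtains u where "u \<in> fp_words I G" "x = fp_rel I G `` {u}"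
  using assms by (auto simp: free_product_def elim: quotientE)

lemma fp_carrier: "u \<in> fp_words I G \<Longrightarrow> fp_rel I G `` {u} \<in> carrier (free_product I G)"
  by (simp add: free_product_def quotientI)

lemma fp_left_inverse:
  assumes G: "\<And>i. i \<in> I \<Longrightarrow> group (G i)" and "u \<in> fp_words I G"
  shows "\<exists>v\<in>fp_words I G. (v @ u, []) \<in> fp_rel I G"
  using assms(2)
proof (induction u)
  case Nil
  then show ?case by (auto simp: fp_words_def intro!: fp_rel.refl bexI[of _ "[]"])
next
  case (Cons p u)
  obtain i a where p: "p = (i, a)" "i \<in> I" "a \<in> carrier (G i)"
    and u: "u \<in> fp_words I G"
    using Cons.prems by (cases p) (auto simp: fp_words_def)
  interpret group "G i" using G p by simp
  obtain v where v: "v \<in> fp_words I G" "(v @ u, []) \<in> fp_rel I G"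
    using Cons.IH u by blast
  let ?b = "inv\<^bsub>G i\<^esub> a"
  have "([(i, ?b), (i, a)], []) \<in> fp_rel I G"
    using fp_rel.trans[OF fp_rel.mult[of i I ?b G a] ] fp_rel.one[of i I G] p by simp
  then have "(v @ ([(i, ?b), (i, a)] @ u), v @ ([] @ u)) \<in> fp_rel I G"
    by (intro fp_rel.append fp_rel.refl u v)
  with v(2) have "((v @ [(i, ?b)]) @ (p # u), []) \<in> fp_rel I G"
    using fp_rel.trans p(1) by fastforce
  moreover have "v @ [(i, ?b)] \<in> fp_words I G"
    using v(1) p by (simp add: fp_words_def)
  ultimately show ?case by blast
qed

lemma group_free_product:
  assumes G: "\<And>i. i \<in> I \<Longrightarrow> group (G i)"
  shows "group (free_product I G)"
proof (rule groupI)
  have one: "\<one>\<^bsub>free_product I G\<^esub> = fp_rel I G `` {[]}" by (simp add: free_product_def)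
  have nil: "[] \<in> fp_words I G" by (simp add: fp_words_def)
  note simps = one fp_mult_class[OF G] fp_words_append nil fp_carrier
  show "\<one>\<^bsub>free_product I G\<^esub> \<in> carrier (free_product I G)" by (simp add: simps)
  fix x assume x: "x \<in> carrier (free_product I G)"
  show "\<one>\<^bsub>free_product I G\<^esub> \<otimes>\<^bsub>free_product I G\<^esub> x = x"
    using x by (elim fp_carrier_cases) (simp add: simps)
  show "\<exists>y\<in>carrier (free_product I G). y \<otimes>\<^bsub>free_product I G\<^esub> x = \<one>\<^bsub>free_product I G\<^esub>"
  proof -
    obtain u where u: "u \<in> fp_words I G" "x = fp_rel I G `` {u}"
      using x by (elim fp_carrier_cases)
    obtain v where v: "v \<in> fp_words I G" "(v @ u, []) \<in> fp_rel I G"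
      using fp_left_inverse[OF G u(1)] by blast
    show ?thesis
      using u v equiv_class_eq[OF equiv_fp_rel[OF G] v(2)]
      by (intro bexI[of _ "fp_rel I G `` {v}"]) (simp_all add: simps)
  qed
  fix y assume y: "y \<in> carrier (free_product I G)"
  show "x \<otimes>\<^bsub>free_product I G\<^esub> y \<in> carrier (free_product I G)"
    using x y by (elim fp_carrier_cases) (simp add: simps)
  fix z assume "z \<in> carrier (free_product I G)"
  with x y show "x \<otimes>\<^bsub>free_product I G\<^esub> y \<otimes>\<^bsub>free_product I G\<^esub> z
      = x \<otimes>\<^bsub>free_product I G\<^esub> (y \<otimes>\<^bsub>free_product I G\<^esub> z)"
    by (elim fp_carrier_cases) (simp add: simps)
qed

lemma fp_incl_hom:
  assumes G: "\<And>i. i \<in> I \<Longrightarrow> group (G i)" and "i \<in> I"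
  shows "fp_incl I G i \<in> hom (G i) (free_product I G)"
  using assms
  by (auto simp: hom_def fp_incl_def fp_mult_class[OF G] fp_words_def
      intro!: fp_carrier equiv_class_eq[OF equiv_fp_rel[OF G], symmetric] fp_rel.mult)

section \<open>Graph products\<close>

definition normal_closure :: "('a, 'b) monoid_scheme \<Rightarrow> 'a set \<Rightarrow> 'a set" where
  "normal_closure G S = \<Inter>{N. N \<lhd> G \<and> S \<subseteq> N}"

definition commutator :: "('a, 'b) monoid_scheme \<Rightarrow> 'a \<Rightarrow> 'a \<Rightarrow> 'a" where
  "commutator G g h = g \<otimes>\<^bsub>G\<^esub> h \<otimes>\<^bsub>G\<^esub> inv\<^bsub>G\<^esub> g \<otimes>\<^bsub>G\<^esub> inv\<^bsub>G\<^esub> h"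

definition graph_product_relators ::
    "'v sgraph \<Rightarrow> ('v \<Rightarrow> ('a, 'b) monoid_scheme) \<Rightarrow> ('v \<times> 'a) list set set" where
  "graph_product_relators \<Gamma> G =
    {commutator (free_product (verts \<Gamma>) G) (fp_incl (verts \<Gamma>) G v g) (fp_incl (verts \<Gamma>) G w h)
      | v w g h. {v, w} \<in> edges \<Gamma> \<and> g \<in> carrier (G v) \<and> h \<in> carrier (G w)}"

definition graph_product ::
    "'v sgraph \<Rightarrow> ('v \<Rightarrow> ('a, 'b) monoid_scheme) \<Rightarrow> ('v \<times> 'a) list set set monoid" where
  "graph_product \<Gamma> G =
    free_product (verts \<Gamma>) G Mod
      normal_closure (free_product (verts \<Gamma>) G) (graph_product_relators \<Gamma> G)"

lemma (in group) normal_closure_normal: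
  assumes "S \<subseteq> carrier G"
  shows "normal_closure G S \<lhd> G"
proof -
  have c: "carrier G \<lhd> G" by (auto simp: normal_inv_iff subgroup_self)
  show ?thesis
    unfolding normal_inv_iff
  proof (intro conjI ballI)
    show "subgroup (normal_closure G S) G"
      unfolding normal_closure_def
      using c assms by (intro subgroups_Inter) (auto dest: normal_imp_subgroup)
    show "x \<otimes> h \<otimes> inv x \<in> normal_closure G S"
      if "x \<in> carrier G" "h \<in> normal_closure G S" for x h
      using that by (auto simp: normal_closure_def intro: normal.inv_op_closed2)
  qed
qed

lemma group_graph_product:
  assumes "simple_graph \<Gamma>" and G: "\<And>v. v \<in> verts \<Gamma> \<Longrightarrow> group (G v)"
  shows "group (graph_product \<Gamma> G)"
proof -
  interpret group "free_product (verts \<Gamma>) G" by (rule group_free_product[OF G])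
  have "graph_product_relators \<Gamma> G \<subseteq> carrier (free_product (verts \<Gamma>) G)"
  proof
    fix x assume "x \<in> graph_product_relators \<Gamma> G"
    then obtain v w g h where x: "x = commutator (free_product (verts \<Gamma>) G)
        (fp_incl (verts \<Gamma>) G v g) (fp_incl (verts \<Gamma>) G w h)"
      and "{v, w} \<in> edges \<Gamma>" "g \<in> carrier (G v)" "h \<in> carrier (G w)"
      by (auto simp: graph_product_relators_def)
    moreover have "v \<in> verts \<Gamma>" "w \<in> verts \<Gamma>"
      using assms(1) \<open>{v, w} \<in> edges \<Gamma>\<close> by (auto simp: simple_graph_def)
    ultimately show "x \<in> carrier (free_product (verts \<Gamma>) G)"
      using hom_in_carrier[OF fp_incl_hom, of "verts \<Gamma>" G] G by (simp add: commutator_def)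
  qed
  then show ?thesis
    unfolding graph_product_def by (intro normal.factorgroup_is_group normal_closure_normal)
qed

section \<open>Semicomplete groups\<close>

definition abelianization :: "('a, 'b) monoid_scheme \<Rightarrow> 'a set monoid" where
  "abelianization G = G Mod derived G (carrier G)"

text \<open>
  An automorphism of \<open>G\<close> permutes the cosets of the derived subgroup, so the automorphism it
  induces on the abelianization is given by taking images of cosets.
\<close>

definition ab_map :: "('a, 'b) monoid_scheme \<Rightarrow> ('a \<Rightarrow> 'a) \<Rightarrow> 'a set \<Rightarrow> 'a set" where
  "ab_map G \<phi> = (\<lambda>A\<in>carrier (abelianization G). \<phi> ` A)"

lemma (in group) ab_map_coset:
  assumes "\<phi> \<in> auto G" and "x \<in> carrier G"
  shows "ab_map G \<phi> (derived G (carrier G) #> x) = derived G (carrier G) #> \<phi> x"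
proof -
  let ?D = "derived G (carrier G)"
  have hom: "\<phi> \<in> hom G G" and bij: "\<phi> ` carrier G = carrier G"
    using assms(1) by (auto simp: auto_def Bij_def bij_betw_def)
  interpret group_hom G G \<phi> by unfold_locales (rule hom)
  have "\<phi> ` ?D = ?D"
    using derived_img[of "carrier G"] bij by simp
  moreover have "\<phi> ` (?D #> x) = \<phi> ` ?D #> \<phi> x"
    using assms(2) derived_in_carrier[of "carrier G"] by (force simp: r_coset_def image_iff)
  ultimately show ?thesis
    using assms(2) by (auto simp: ab_map_def abelianization_def FactGroup_def RCOSETS_def)
qed

definition IA :: "('a, 'b) monoid_scheme \<Rightarrow> ('a \<Rightarrow> 'a) set" where
  "IA G = kernel (AutoGroup G) (AutoGroup (abelianization G)) (ab_map G)"

definition Inn :: "('a, 'b) monoid_scheme \<Rightarrow> ('a \<Rightarrow> 'a) set" where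
  "Inn G = (\<lambda>g. \<lambda>x\<in>carrier G. g \<otimes>\<^bsub>G\<^esub> x \<otimes>\<^bsub>G\<^esub> inv\<^bsub>G\<^esub> g) ` carrier G"

definition semicomplete :: "('a, 'b) monoid_scheme \<Rightarrow> bool" where
  "semicomplete G \<longleftrightarrow> IA G = Inn G"

end

theory Submission
  imports Defs
begin

text \<open>
  Write \<open>P\<close> for \<open>G\<^sub>\<Gamma>\<close> and \<open>Q\<close> for the graph product over the non-cone vertices. Killing the cone
  vertices retracts \<open>P\<close> onto \<open>Q\<close>, and the kernel \<open>A\<close> is central, so \<open>P = A \<times> Q\<close> and \<open>P' = Q'\<close>. If
  \<open>Q\<close> is centreless, an automorphism in \<open>IA(P)\<close> sends \<open>a \<in> A\<close> to a central element of the coset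
  \<open>a Q'\<close>, hence fixes \<open>a\<close>; it also preserves \<open>Q\<close>. Thus \<open>IA(P)\<close> and \<open>IA(Q)\<close> correspond to each
  other by restriction and extension by the identity on \<open>A\<close>, and so do the inner automorphisms.

  To see that a graph product without cone vertices is centreless, choose for a vertex \<open>v\<close> a
  non-adjacent vertex \<open>u \<noteq> v\<close>. The kernel of the retraction \<open>\<rho>\<^sub>v\<close> killing \<open>v\<close> is a free product of
  conjugates of \<open>G\<^sub>v\<close>, on whose reduced words the graph product acts: \<open>G\<^sub>v\<close> by left multiplication in
  one distinguished factor (van der Waerden), the other vertex groups by permuting the factors. If \<open>z\<close>
  is central, then \<open>z\<close> applied to the empty word is fixed by \<open>G\<^sub>u\<close>, which acts freely on factors;
  so that word is empty and \<open>\<rho>\<^sub>v z = z\<close>. As this holds for every \<open>v\<close>, we get \<open>z = 1\<close>.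
\<close>

section \<open>The universal property of graph products\<close>

text \<open>The family \<open>f\<close> may also be the projection \<open>fst\<close> itself:
  further below, the index of a letter is a pair whose first component is a map into the target
  group, and \<open>word_eval\<close> multiplies out such words.\<close>

definition word_eval :: "('c, 'd) monoid_scheme \<Rightarrow> ('i \<Rightarrow> 'a \<Rightarrow> 'c) \<Rightarrow> ('i \<times> 'a) list \<Rightarrow> 'c" where
  "word_eval T f u = foldr (\<lambda>(i, a) x. f i a \<otimes>\<^bsub>T\<^esub> x) u \<one>\<^bsub>T\<^esub>"

lemma word_eval_simps [simp]:
  "word_eval T f [] = \<one>\<^bsub>T\<^esub>"
  "word_eval T f (p # u) = f (fst p) (snd p) \<otimes>\<^bsub>T\<^esub> word_eval T f u"
  by (simp_all add: word_eval_def case_prod_beta)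

context group
begin

lemma word_eval_closed:
  assumes "\<And>p. p \<in> set u \<Longrightarrow> f (fst p) (snd p) \<in> carrier G"
  shows "word_eval G f u \<in> carrier G"
  using assms by (induction u) auto

lemma word_eval_append:
  assumes "\<And>p. p \<in> set u \<union> set v \<Longrightarrow> f (fst p) (snd p) \<in> carrier G"
  shows "word_eval G f (u @ v) = word_eval G f u \<otimes> word_eval G f v"
  using assms by (induction u) (auto simp: m_assoc word_eval_closed)

lemma inv_mult_cancel:
  assumes "x \<in> carrier G" "y \<in> carrier G"
  shows "inv x \<otimes> (x \<otimes> y) = y" "x \<otimes> (inv x \<otimes> y) = y"
  using assms by (simp_all flip: m_assoc)

lemma commute_if_commutator_eq_one:
  assumes "x \<in> carrier G" "y \<in> carrier G" "x \<otimes> y \<otimes> inv x \<otimes> inv y = \<one>"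
  shows "x \<otimes> y = y \<otimes> x"
proof -
  have "x \<otimes> y \<otimes> inv x = y"
    using inv_solve_right[of \<one> "x \<otimes> y \<otimes> inv x" y] assms by simp
  then show ?thesis using inv_solve_right[of y "x \<otimes> y" x] assms by simp
qed

end

text \<open>Evaluating words through the maps \<open>f i\<close> respects each generating rule of
  \<open>fp_rel\<close>, so it descends to classes.\<close>

lemma free_product_lift:
  fixes T :: "('c, 'd) monoid_scheme" and G :: "'i \<Rightarrow> ('a, 'b) monoid_scheme"
  assumes G: "\<And>i. i \<in> I \<Longrightarrow> group (G i)" and T: "group T"
    and f: "\<And>i. i \<in> I \<Longrightarrow> f i \<in> hom (G i) T"
  obtains h where "h \<in> hom (free_product I G) T"
    "\<And>i a. \<lbrakk>i \<in> I; a \<in> carrier (G i)\<rbrakk> \<Longrightarrow> h (fp_incl I G i a) = f i a"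
proof -
  interpret T: group T by (rule T)
  let ?e = "word_eval T f"
  note E = equiv_fp_rel[of I G, OF G]
  have fc: "f i a \<in> carrier T" if "i \<in> I" "a \<in> carrier (G i)" for i a
    using f that by (auto simp: hom_def)
  have wc: "f (fst p) (snd p) \<in> carrier T" if "u \<in> fp_words I G" "p \<in> set u" for u p
    using that fc by (auto simp: fp_words_def)
  have eapp: "?e (u @ v) = ?e u \<otimes>\<^bsub>T\<^esub> ?e v" if "u \<in> fp_words I G" "v \<in> fp_words I G" for u v
    using that wc by (intro T.word_eval_append) auto
  have inv: "?e u = ?e v" if "(u, v) \<in> fp_rel I G" for u v
    using that
  proof induction
    case (one i)
    interpret i: group "G i" using G one by simp
    interpret group_hom "G i" T "f i" by unfold_locales (rule f[OF one])
    show ?case by simp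
  next
    case (mult i a b)
    then show ?case using f[OF mult(1)] by (simp add: hom_def fc)
  next
    case (append u u' v v')
    then have "u \<in> fp_words I G" "v \<in> fp_words I G" "u' \<in> fp_words I G" "v' \<in> fp_words I G"
      using fp_rel_words[of I G, OF G] by simp_all
    then show ?case using append.IH by (simp add: eapp)
  qed auto
  \<comment> \<open>\<open>?e\<close> is constant on each class, so the image of a class is a
    singleton and \<open>the_elem\<close> reads off its value.\<close>
  define h where "h A = the_elem (?e ` A)" for A
  have h: "h (fp_rel I G `` {u}) = ?e u" if "u \<in> fp_words I G" for u
  proof -
    have "?e ` (fp_rel I G `` {u}) = {?e u}"
    proof
      show "?e ` (fp_rel I G `` {u}) \<subseteq> {?e u}" by (auto dest: inv[symmetric])
      show "{?e u} \<subseteq> ?e ` (fp_rel I G `` {u})" using fp_rel.refl[OF that] by blast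
    qed
    then show ?thesis by (simp add: h_def)
  qed
  show thesis
  proof
    show "h \<in> hom (free_product I G) T"
    proof (rule homI)
      fix x y assume "x \<in> carrier (free_product I G)" "y \<in> carrier (free_product I G)"
      then show "h (x \<otimes>\<^bsub>free_product I G\<^esub> y) = h x \<otimes>\<^bsub>T\<^esub> h y"
        by (elim fp_carrier_cases) (simp add: h fp_mult_class[OF G] fp_words_append eapp)
    next
      fix x assume "x \<in> carrier (free_product I G)"
      then show "h x \<in> carrier T"
        by (elim fp_carrier_cases) (simp add: h wc T.word_eval_closed)
    qed
    show "h (fp_incl I G i a) = f i a" if "i \<in> I" "a \<in> carrier (G i)" for i a
      using that by (subst fp_incl_def, subst h) (auto simp: fp_words_def fc)
  qed
qed

lemma normal_closure_subset:
  "N \<lhd> G \<Longrightarrow> S \<subseteq> N \<Longrightarrow> normal_closure G S \<subseteq> N"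
  by (auto simp: normal_closure_def)

lemma normal_closure_superset: "S \<subseteq> normal_closure G S"
  by (auto simp: normal_closure_def)

section \<open>Generators, induction and lifting for graph products\<close>

definition gp_incl ::
    "'v sgraph \<Rightarrow> ('v \<Rightarrow> ('a, 'b) monoid_scheme) \<Rightarrow> 'v \<Rightarrow> 'a \<Rightarrow> ('v \<times> 'a) list set set" where
  "gp_incl \<Gamma> G v a =
    normal_closure (free_product (verts \<Gamma>) G) (graph_product_relators \<Gamma> G)
      #>\<^bsub>free_product (verts \<Gamma>) G\<^esub> fp_incl (verts \<Gamma>) G v a"

locale graph_of_groups =
  fixes \<Gamma> :: "'v sgraph" and G :: "'v \<Rightarrow> ('a, 'b) monoid_scheme"
  assumes simple: "simple_graph \<Gamma>"
    and vertex_group: "\<And>v. v \<in> verts \<Gamma> \<Longrightarrow> group (G v)"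
begin

abbreviation F where "F \<equiv> free_product (verts \<Gamma>) G"
abbreviation N where "N \<equiv> normal_closure F (graph_product_relators \<Gamma> G)"
abbreviation P where "P \<equiv> graph_product \<Gamma> G"
abbreviation \<iota> where "\<iota> \<equiv> gp_incl \<Gamma> G"

sublocale F: group F by (rule group_free_product[OF vertex_group])
sublocale P: group P by (rule group_graph_product[OF simple vertex_group])

lemma edge_verts: "{v, w} \<in> edges \<Gamma> \<Longrightarrow> v \<in> verts \<Gamma> \<and> w \<in> verts \<Gamma>"
  using simple by (auto simp: simple_graph_def)

lemma edge_neq: "{v, w} \<in> edges \<Gamma> \<Longrightarrow> v \<noteq> w"
  using simple by (auto simp: simple_graph_def)

lemma fp_incl_closed:
  "\<lbrakk>v \<in> verts \<Gamma>; a \<in> carrier (G v)\<rbrakk> \<Longrightarrow> fp_incl (verts \<Gamma>) G v a \<in> carrier F"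
  using hom_in_carrier[OF fp_incl_hom] vertex_group by metis

lemma relators_subset: "graph_product_relators \<Gamma> G \<subseteq> carrier F"
  using edge_verts by (auto simp: graph_product_relators_def commutator_def fp_incl_closed)

lemma normal_N: "N \<lhd> F"
  by (rule F.normal_closure_normal[OF relators_subset])

lemma proj_hom: "(\<lambda>x. N #>\<^bsub>F\<^esub> x) \<in> hom F P"
  using normal.r_coset_hom_Mod[OF normal_N] by (simp add: graph_product_def)

lemma incl_hom: "v \<in> verts \<Gamma> \<Longrightarrow> \<iota> v \<in> hom (G v) P"
  using hom_compose[OF fp_incl_hom[where I = "verts \<Gamma>" and G = G and i = v] proj_hom] vertex_group
  by (simp add: gp_incl_def[abs_def] comp_def)

lemma incl_closed [simp, intro]: "\<lbrakk>v \<in> verts \<Gamma>; a \<in> carrier (G v)\<rbrakk> \<Longrightarrow> \<iota> v a \<in> carrier P"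
  using incl_hom by (rule hom_in_carrier)

lemma incl_mult:
  "\<lbrakk>v \<in> verts \<Gamma>; a \<in> carrier (G v); b \<in> carrier (G v)\<rbrakk>
    \<Longrightarrow> \<iota> v (a \<otimes>\<^bsub>G v\<^esub> b) = \<iota> v a \<otimes>\<^bsub>P\<^esub> \<iota> v b"
  using incl_hom by (rule hom_mult)

lemma incl_one: "v \<in> verts \<Gamma> \<Longrightarrow> \<iota> v \<one>\<^bsub>G v\<^esub> = \<one>\<^bsub>P\<^esub>"
  using incl_hom vertex_group P.is_group by (intro hom_one)

text \<open>The commutator of the two letters is a relator, so its coset modulo \<open>N\<close> is
  trivial.\<close>

lemma incl_commute:
  assumes e: "{v, w} \<in> edges \<Gamma>" and a: "a \<in> carrier (G v)" and b: "b \<in> carrier (G w)"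
  shows "\<iota> v a \<otimes>\<^bsub>P\<^esub> \<iota> w b = \<iota> w b \<otimes>\<^bsub>P\<^esub> \<iota> v a"
proof -
  interpret p: group_hom F P "\<lambda>x. N #>\<^bsub>F\<^esub> x" by unfold_locales (rule proj_hom)
  note vw = edge_verts[OF e]
  let ?x = "fp_incl (verts \<Gamma>) G v a" and ?y = "fp_incl (verts \<Gamma>) G w b"
  have xy: "?x \<in> carrier F" "?y \<in> carrier F" using vw a b by (auto intro: fp_incl_closed)
  have "commutator F ?x ?y \<in> N"
    using normal_closure_superset e a b by (fastforce simp: graph_product_relators_def)
  then have "N #>\<^bsub>F\<^esub> commutator F ?x ?y = \<one>\<^bsub>P\<^esub>"
    using F.coset_join2[OF _ normal_imp_subgroup[OF normal_N]] xy
    by (simp add: commutator_def graph_product_def)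
  then have "\<iota> v a \<otimes>\<^bsub>P\<^esub> \<iota> w b \<otimes>\<^bsub>P\<^esub> inv\<^bsub>P\<^esub> \<iota> v a \<otimes>\<^bsub>P\<^esub> inv\<^bsub>P\<^esub> \<iota> w b = \<one>\<^bsub>P\<^esub>"
    using xy by (simp add: commutator_def gp_incl_def)
  then show ?thesis
    using vw a b by (intro P.commute_if_commutator_eq_one) simp_all
qed

text \<open>Each element is the coset of the class of some word, and the induction peels off the
  first letter. Thus a property of all elements is reduced to left multiplication by one
  letter.\<close>

lemma graph_product_induct [consumes 1, case_names one incl]:
  assumes p: "p \<in> carrier P" and one: "Q \<one>\<^bsub>P\<^esub>"
    and step: "\<And>v a p. \<lbrakk>v \<in> verts \<Gamma>; a \<in> carrier (G v); p \<in> carrier P; Q p\<rbrakk> \<Longrightarrow> Q (\<iota> v a \<otimes>\<^bsub>P\<^esub> p)"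
  shows "Q p"
proof -
  interpret p: group_hom F P "\<lambda>x. N #>\<^bsub>F\<^esub> x" by unfold_locales (rule proj_hom)
  obtain x where x: "x \<in> carrier F" "p = N #>\<^bsub>F\<^esub> x"
    using p by (auto simp: graph_product_def carrier_FactGroup)
  obtain u where u: "u \<in> fp_words (verts \<Gamma>) G" "x = fp_rel (verts \<Gamma>) G `` {u}"
    using x(1) by (rule fp_carrier_cases)
  have "Q (N #>\<^bsub>F\<^esub> (fp_rel (verts \<Gamma>) G `` {u}))"
    using u(1)
  proof (induction u)
    case Nil
    have "N #>\<^bsub>F\<^esub> \<one>\<^bsub>F\<^esub> = \<one>\<^bsub>P\<^esub>" by (rule p.hom_one)
    then show ?case using one by (simp add: free_product_def)
  next
    case (Cons l u)
    obtain v a where l: "l = (v, a)" "v \<in> verts \<Gamma>" "a \<in> carrier (G v)"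
      and u: "u \<in> fp_words (verts \<Gamma>) G"
      using Cons.prems by (cases l) (auto simp: fp_words_def)
    have "[l] \<in> fp_words (verts \<Gamma>) G" using l by (simp add: fp_words_def)
    then have "fp_rel (verts \<Gamma>) G `` {l # u}
        = fp_incl (verts \<Gamma>) G v a \<otimes>\<^bsub>F\<^esub> fp_rel (verts \<Gamma>) G `` {u}"
      using fp_mult_class[OF vertex_group, where u = "[l]" and v = u] u l by (simp add: fp_incl_def)
    then have "N #>\<^bsub>F\<^esub> (fp_rel (verts \<Gamma>) G `` {l # u})
        = \<iota> v a \<otimes>\<^bsub>P\<^esub> (N #>\<^bsub>F\<^esub> (fp_rel (verts \<Gamma>) G `` {u}))"
      using l u by (simp add: gp_incl_def fp_incl_closed fp_carrier)
    then show ?case using step l u Cons.IH by (simp add: fp_carrier)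
  qed
  then show ?thesis using u x by simp
qed

text \<open>The lift to the free product sends every relator to a commutator of commuting elements.
  Its kernel is normal, hence contains \<open>N\<close>, and the lift factors through the
  quotient.\<close>

lemma graph_product_lift:
  fixes T :: "('c, 'd) monoid_scheme"
  assumes T: "group T"
    and f: "\<And>v. v \<in> verts \<Gamma> \<Longrightarrow> f v \<in> hom (G v) T"
    and comm: "\<And>v w a b. \<lbrakk>{v, w} \<in> edges \<Gamma>; a \<in> carrier (G v); b \<in> carrier (G w)\<rbrakk>
      \<Longrightarrow> f v a \<otimes>\<^bsub>T\<^esub> f w b = f w b \<otimes>\<^bsub>T\<^esub> f v a"
  obtains h where "h \<in> hom P T" "\<And>v a. \<lbrakk>v \<in> verts \<Gamma>; a \<in> carrier (G v)\<rbrakk> \<Longrightarrow> h (\<iota> v a) = f v a"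
proof -
  interpret T: group T by (rule T)
  obtain h0 where h0: "h0 \<in> hom F T"
    "\<And>v a. \<lbrakk>v \<in> verts \<Gamma>; a \<in> carrier (G v)\<rbrakk> \<Longrightarrow> h0 (fp_incl (verts \<Gamma>) G v a) = f v a"
    by (rule free_product_lift[of "verts \<Gamma>" G T f, OF vertex_group T f]) (assumption, assumption, rule that)
  interpret h0: group_hom F T h0 by unfold_locales (rule h0)
  have fc: "f v a \<in> carrier T" if "v \<in> verts \<Gamma>" "a \<in> carrier (G v)" for v a
    using f that by (auto simp: hom_def)
  have "graph_product_relators \<Gamma> G \<subseteq> kernel F T h0"
  proof
    fix x assume x: "x \<in> graph_product_relators \<Gamma> G"
    then obtain v w a b where e: "{v, w} \<in> edges \<Gamma>" and ab: "a \<in> carrier (G v)" "b \<in> carrier (G w)"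
      and x': "x = commutator F (fp_incl (verts \<Gamma>) G v a) (fp_incl (verts \<Gamma>) G w b)"
      by (auto simp: graph_product_relators_def)
    note vw = edge_verts[OF e]
    have "h0 x = commutator T (f v a) (f w b)"
      using vw ab by (simp add: x' commutator_def fp_incl_closed h0(2))
    also have "\<dots> = \<one>\<^bsub>T\<^esub>"
      using comm[OF e ab] vw ab fc by (simp add: commutator_def T.m_assoc)
    finally show "x \<in> kernel F T h0" using x relators_subset by (auto simp: kernel_def)
  qed
  then have "N \<subseteq> kernel F T h0" by (intro normal_closure_subset h0.normal_kernel)
  then obtain h where h: "h \<in> hom (F Mod N) T" "\<And>x. x \<in> carrier F \<Longrightarrow> h (N #>\<^bsub>F\<^esub> x) = h0 x"
    by (rule h0.FactGroup_universal_kernel[OF normal_N]) (rule that)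
  show thesis
  proof
    show "h \<in> hom P T" using h(1) by (simp add: graph_product_def)
    show "h (\<iota> v a) = f v a" if "v \<in> verts \<Gamma>" "a \<in> carrier (G v)" for v a
      using that by (simp add: gp_incl_def h(2) fp_incl_closed h0(2))
  qed
qed

text \<open>Uniqueness in the universal property: it turns comparisons of homomorphisms into checks
  on letters.\<close>

lemma graph_product_hom_eq:
  assumes T: "group T" and "h \<in> hom P T" "k \<in> hom P T" and p: "p \<in> carrier P"
    and eq: "\<And>v a. \<lbrakk>v \<in> verts \<Gamma>; a \<in> carrier (G v)\<rbrakk> \<Longrightarrow> h (\<iota> v a) = k (\<iota> v a)"
  shows "h p = k p"
proof -
  interpret T: group T by (rule T)
  interpret h: group_hom P T h by unfold_locales fact
  interpret k: group_hom P T k by unfold_locales fact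
  show ?thesis using p by (induction rule: graph_product_induct) (simp_all add: eq)
qed

end

section \<open>Actions on reduced words\<close>

text \<open>The inverse of the permutation given by \<open>g\<close> is the one given by the inverse
  of \<open>g\<close>. The restriction to \<open>S\<close> appears because elements of
  \<open>BijGroup S\<close> are extensional.\<close>

lemma group_action_hom:
  fixes K :: "('a, 'b) monoid_scheme"
  assumes K: "group K"
    and closed: "\<And>g x. \<lbrakk>g \<in> carrier K; x \<in> S\<rbrakk> \<Longrightarrow> act g x \<in> S"
    and one: "\<And>x. x \<in> S \<Longrightarrow> act \<one>\<^bsub>K\<^esub> x = x"
    and mult: "\<And>g h x. \<lbrakk>g \<in> carrier K; h \<in> carrier K; x \<in> S\<rbrakk>
      \<Longrightarrow> act (g \<otimes>\<^bsub>K\<^esub> h) x = act g (act h x)"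
  shows "(\<lambda>g. \<lambda>x\<in>S. act g x) \<in> hom K (BijGroup S)"
proof -
  interpret K: group K by (rule K)
  have Bij: "(\<lambda>x\<in>S. act g x) \<in> Bij S" if g: "g \<in> carrier K" for g
  proof -
    have "bij_betw (\<lambda>x\<in>S. act g x) S S"
    proof (rule bij_betw_byWitness)
      show "\<forall>x\<in>S. act (inv\<^bsub>K\<^esub> g) ((\<lambda>x\<in>S. act g x) x) = x"
        using g by (simp add: one flip: mult)
      show "\<forall>x\<in>S. (\<lambda>x\<in>S. act g x) (act (inv\<^bsub>K\<^esub> g) x) = x"
        using g by (simp add: closed one flip: mult)
    qed (use g closed in auto)
    then show ?thesis by (simp add: Bij_def)
  qed
  show ?thesis
    by (rule homI) (auto simp: BijGroup_def Bij mult closed compose_def fun_eq_iff)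
qed

lemma BijGroup_mult_apply:
  "\<lbrakk>f \<in> carrier (BijGroup S); g \<in> carrier (BijGroup S); x \<in> S\<rbrakk>
    \<Longrightarrow> (f \<otimes>\<^bsub>BijGroup S\<^esub> g) x = f (g x)"
  by (simp add: BijGroup_def compose_def)

lemma BijGroup_eqI:
  assumes "f \<in> carrier (BijGroup S)" "g \<in> carrier (BijGroup S)" "\<And>x. x \<in> S \<Longrightarrow> f x = g x"
  shows "f = g"
  using assms by (auto simp: BijGroup_def Bij_def intro: extensionalityI)

section \<open>Van der Waerden's action on normal forms of a free product of copies of one
  group\<close>

definition reduced_words :: "'i set \<Rightarrow> ('a, 'b) monoid_scheme \<Rightarrow> ('i \<times> 'a) list set" where
  "reduced_words \<Omega> K =
    {w \<in> lists (\<Omega> \<times> (carrier K - {\<one>\<^bsub>K\<^esub>})). successively (\<lambda>p q. fst p \<noteq> fst q) w}"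

text \<open>With \<open>head_at\<close> and \<open>tail_at\<close>, this encodes the unique
  splitting of a reduced word into a syllable at \<open>\<omega>\<close>, trivial if the word does
  not start there, and a remainder that does not start at \<open>\<omega>\<close>.\<close>

definition push :: "('a, 'b) monoid_scheme \<Rightarrow> 'i \<Rightarrow> 'a \<Rightarrow> ('i \<times> 'a) list \<Rightarrow> ('i \<times> 'a) list" where
  "push K \<omega> a w = (if a = \<one>\<^bsub>K\<^esub> then w else (\<omega>, a) # w)"

definition head_at :: "('a, 'b) monoid_scheme \<Rightarrow> 'i \<Rightarrow> ('i \<times> 'a) list \<Rightarrow> 'a" where
  "head_at K \<omega> w = (if w \<noteq> [] \<and> fst (hd w) = \<omega> then snd (hd w) else \<one>\<^bsub>K\<^esub>)"

definition tail_at :: "'i \<Rightarrow> ('i \<times> 'a) list \<Rightarrow> ('i \<times> 'a) list" where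
  "tail_at \<omega> w = (if w \<noteq> [] \<and> fst (hd w) = \<omega> then tl w else w)"

text \<open>Left multiplication by an element of the factor \<open>\<omega>\<close>, carried out on
  normal forms. Cancellation happens where \<open>push\<close> drops a trivial syllable.\<close>

definition letter_act ::
    "('a, 'b) monoid_scheme \<Rightarrow> 'i \<Rightarrow> 'a \<Rightarrow> ('i \<times> 'a) list \<Rightarrow> ('i \<times> 'a) list" where
  "letter_act K \<omega> g w = push K \<omega> (g \<otimes>\<^bsub>K\<^esub> head_at K \<omega> w) (tail_at \<omega> w)"

lemma reduced_words_Cons:
  "p # w \<in> reduced_words \<Omega> K \<longleftrightarrow>
    fst p \<in> \<Omega> \<and> snd p \<in> carrier K \<and> snd p \<noteq> \<one>\<^bsub>K\<^esub> \<and> w \<in> reduced_words \<Omega> K \<and>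
    (w \<noteq> [] \<longrightarrow> fst p \<noteq> fst (hd w))"
  by (cases p) (auto simp: reduced_words_def successively_Cons)

lemma Nil_reduced [simp]: "[] \<in> reduced_words \<Omega> K"
  by (simp add: reduced_words_def)

context group
begin

lemma head_at_closed [simp]: "w \<in> reduced_words \<Omega> G \<Longrightarrow> head_at G \<omega> w \<in> carrier G"
  by (cases w) (auto simp: head_at_def reduced_words_Cons)

lemma tail_at_closed [simp]: "w \<in> reduced_words \<Omega> G \<Longrightarrow> tail_at \<omega> w \<in> reduced_words \<Omega> G"
  by (cases w) (auto simp: tail_at_def reduced_words_Cons)

lemma tail_at_hd: "w \<in> reduced_words \<Omega> G \<Longrightarrow> tail_at \<omega> w = [] \<or> fst (hd (tail_at \<omega> w)) \<noteq> \<omega>"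
  by (cases w) (auto simp: tail_at_def reduced_words_Cons)

lemma push_head_tail: "w \<in> reduced_words \<Omega> G \<Longrightarrow> push G \<omega> (head_at G \<omega> w) (tail_at \<omega> w) = w"
  by (cases w) (auto simp: push_def head_at_def tail_at_def reduced_words_Cons)

lemma head_at_push: "w = [] \<or> fst (hd w) \<noteq> \<omega> \<Longrightarrow> head_at G \<omega> (push G \<omega> a w) = a"
  by (auto simp: push_def head_at_def)

lemma tail_at_push: "w = [] \<or> fst (hd w) \<noteq> \<omega> \<Longrightarrow> tail_at \<omega> (push G \<omega> a w) = w"
  by (auto simp: push_def tail_at_def)

lemma letter_act_closed [simp]:
  assumes "\<omega> \<in> \<Omega>" "g \<in> carrier G" "w \<in> reduced_words \<Omega> G"
  shows "letter_act G \<omega> g w \<in> reduced_words \<Omega> G"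
  using assms tail_at_hd[of w \<Omega> \<omega>] by (auto simp: letter_act_def push_def reduced_words_Cons)

lemma letter_act_one: "w \<in> reduced_words \<Omega> G \<Longrightarrow> letter_act G \<omega> \<one> w = w"
  using push_head_tail by (simp add: letter_act_def)

text \<open>The action only multiplies the head and leaves the remainder alone, and
  \<open>head_at\<close> and \<open>tail_at\<close> recover both after \<open>push\<close>.
  Associativity in the group then suffices, without cases for cancellation.\<close>

lemma letter_act_mult:
  assumes "g \<in> carrier G" "h \<in> carrier G" "w \<in> reduced_words \<Omega> G"
  shows "letter_act G \<omega> (g \<otimes> h) w = letter_act G \<omega> g (letter_act G \<omega> h w)"
  using assms tail_at_hd[of w \<Omega> \<omega>]
  by (simp add: letter_act_def head_at_push tail_at_push m_assoc)

end

text \<open>Injectivity keeps the indices of adjacent letters distinct.\<close>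

lemma map_reduced_words:
  assumes "\<sigma> \<in> \<Omega> \<rightarrow> \<Omega>" "inj_on \<sigma> \<Omega>" "w \<in> reduced_words \<Omega> K"
  shows "map (apfst \<sigma>) w \<in> reduced_words \<Omega> K"
  using assms(3)
proof (induction w)
  case (Cons p w)
  have "fst (hd w) \<in> \<Omega>" if "w \<noteq> []"
    using that Cons.prems by (cases w) (auto simp: reduced_words_Cons)
  then show ?case
    using Cons assms(1,2) by (auto simp: reduced_words_Cons hd_map dest: inj_onD)
qed simp

text \<open>As \<open>\<sigma>\<close> is injective and fixes \<open>\<omega>\<close>, a word starts
  at \<open>\<omega>\<close> before the renaming exactly if it does so afterwards.\<close>

lemma letter_act_map:
  assumes "inj_on \<sigma> \<Omega>" "\<omega> \<in> \<Omega>" "\<sigma> \<omega> = \<omega>" "w \<in> reduced_words \<Omega> K"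
  shows "letter_act K \<omega> g (map (apfst \<sigma>) w) = map (apfst \<sigma>) (letter_act K \<omega> g w)"
proof (cases w)
  case (Cons p t)
  then have "fst p \<in> \<Omega>" using assms(4) by (simp add: reduced_words_Cons)
  then have "\<sigma> (fst p) = \<omega> \<longleftrightarrow> fst p = \<omega>" using assms by (metis inj_onD)
  then show ?thesis
    using Cons assms(3) by (simp add: letter_act_def push_def head_at_def tail_at_def)
qed (simp add: letter_act_def push_def head_at_def tail_at_def assms(3))

section \<open>The centre of a graph product\<close>

definition centre :: "('a, 'b) monoid_scheme \<Rightarrow> 'a set" where
  "centre G = {z \<in> carrier G. \<forall>x\<in>carrier G. z \<otimes>\<^bsub>G\<^esub> x = x \<otimes>\<^bsub>G\<^esub> z}"

lemma (in graph_of_groups) retraction: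
  obtains \<rho> where "\<rho> \<in> hom P P"
    "\<And>w x. \<lbrakk>w \<in> verts \<Gamma>; x \<in> carrier (G w)\<rbrakk> \<Longrightarrow> \<rho> (\<iota> w x) = (if w \<in> S then \<one>\<^bsub>P\<^esub> else \<iota> w x)"
proof (rule graph_product_lift[of P "\<lambda>w x. if w \<in> S then \<one>\<^bsub>P\<^esub> else \<iota> w x"])
  show "group P" by (rule P.is_group)
  show "(\<lambda>x. if w \<in> S then \<one>\<^bsub>P\<^esub> else \<iota> w x) \<in> hom (G w) P" if "w \<in> verts \<Gamma>" for w
    using that by (auto simp: hom_def incl_mult)
  fix w w' x x' assume e: "{w, w'} \<in> edges \<Gamma>" "x \<in> carrier (G w)" "x' \<in> carrier (G w')"
  show "(if w \<in> S then \<one>\<^bsub>P\<^esub> else \<iota> w x) \<otimes>\<^bsub>P\<^esub> (if w' \<in> S then \<one>\<^bsub>P\<^esub> else \<iota> w' x')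
      = (if w' \<in> S then \<one>\<^bsub>P\<^esub> else \<iota> w' x') \<otimes>\<^bsub>P\<^esub> (if w \<in> S then \<one>\<^bsub>P\<^esub> else \<iota> w x)"
    using edge_verts[OF e(1)] e by (simp add: incl_commute)
qed (rule that)

section \<open>The action attached to a pair of non-adjacent vertices\<close>

locale nonadjacent = graph_of_groups \<Gamma> G
  for \<Gamma> :: "'v sgraph" and G :: "'v \<Rightarrow> ('a, 'b) monoid_scheme" +
  fixes u v :: 'v
  assumes u: "u \<in> verts \<Gamma>" and v: "v \<in> verts \<Gamma>" and uv: "u \<noteq> v" "{u, v} \<notin> edges \<Gamma>"
begin

text \<open>
  The names of the free factors. The name of the conjugate of \<open>G\<^sub>v\<close> by \<open>k\<close> records the embedding
  \<open>a \<mapsto> k a (inv k)\<close>, which avoids cosets of the link of \<open>v\<close>, together with the \<open>G\<^sub>u\<close>-component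
  of \<open>k\<close>, which makes the action of \<open>G\<^sub>u\<close> on names visibly free.
\<close>

definition \<Omega> :: "(('a \<Rightarrow> ('v \<times> 'a) list set set) \<times> 'a) set" where
  "\<Omega> = {c. \<forall>a. c a \<in> carrier P} \<times> carrier (G u)"

text \<open>The name of \<open>G v\<close> itself, that is, of the conjugate by the identity. The
  value outside the carrier of \<open>G v\<close> is a default that keeps all values in
  \<open>P\<close>, as membership in \<open>\<Omega>\<close> demands.\<close>

definition \<omega>0 :: "('a \<Rightarrow> ('v \<times> 'a) list set set) \<times> 'a" where
  "\<omega>0 = (\<lambda>a. if a \<in> carrier (G v) then \<iota> v a else \<one>\<^bsub>P\<^esub>, \<one>\<^bsub>G u\<^esub>)"

text \<open>Replaces the conjugating element \<open>k\<close> by its left multiple by the letter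
  \<open>\<iota> w x\<close>: the embedding is conjugated further, and the
  \<open>G u\<close>-component of \<open>k\<close> changes only if \<open>w = u\<close>.\<close>

definition relabel where
  "relabel w x = (\<lambda>(c, y). (\<lambda>a. \<iota> w x \<otimes>\<^bsub>P\<^esub> c a \<otimes>\<^bsub>P\<^esub> inv\<^bsub>P\<^esub> \<iota> w x, if w = u then x \<otimes>\<^bsub>G u\<^esub> y else y))"

abbreviation R where "R \<equiv> reduced_words \<Omega> (G v)"

text \<open>This mirrors the splitting of \<open>P\<close> into the kernel of the retraction killing
  \<open>v\<close> and its image: \<open>G v\<close> lies in the kernel and multiplies from the
  left, while the other vertex groups lie in the image and act by conjugation.\<close>

definition vertex_act where
  "vertex_act w x = (if w = v then letter_act (G v) \<omega>0 x else map (apfst (relabel w x)))"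

sublocale Gu: group "G u" using vertex_group u .
sublocale Gv: group "G v" using vertex_group v .

lemma \<omega>0_mem: "\<omega>0 \<in> \<Omega>"
  using v by (auto simp: \<omega>0_def \<Omega>_def)

lemma relabel_closed: "\<lbrakk>w \<in> verts \<Gamma>; x \<in> carrier (G w)\<rbrakk> \<Longrightarrow> relabel w x \<in> \<Omega> \<rightarrow> \<Omega>"
  by (auto simp: relabel_def \<Omega>_def)

lemma relabel_one: "\<lbrakk>w \<in> verts \<Gamma>; \<omega> \<in> \<Omega>\<rbrakk> \<Longrightarrow> relabel w \<one>\<^bsub>G w\<^esub> \<omega> = \<omega>"
  by (auto simp: relabel_def \<Omega>_def incl_one)

lemma relabel_mult:
  assumes "w \<in> verts \<Gamma>" "x \<in> carrier (G w)" "y \<in> carrier (G w)" "\<omega> \<in> \<Omega>"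
  shows "relabel w (x \<otimes>\<^bsub>G w\<^esub> y) \<omega> = relabel w x (relabel w y \<omega>)"
  using assms by (auto simp: relabel_def \<Omega>_def incl_mult P.m_assoc P.inv_mult_group Gu.m_assoc)

lemma relabel_inj:
  assumes "w \<in> verts \<Gamma>" "x \<in> carrier (G w)"
  shows "inj_on (relabel w x) \<Omega>"
proof (rule inj_on_inverseI)
  interpret w: group "G w" using vertex_group assms by blast
  show "relabel w (inv\<^bsub>G w\<^esub> x) (relabel w x \<omega>) = \<omega>" if "\<omega> \<in> \<Omega>" for \<omega>
    using assms that by (simp add: relabel_one flip: relabel_mult)
qed

text \<open>Conjugations by commuting elements commute, and at most one end of an edge is
  \<open>u\<close>, so at most one of the two maps touches the second component.\<close>

lemma relabel_commute:
  assumes "{w, w'} \<in> edges \<Gamma>" "x \<in> carrier (G w)" "x' \<in> carrier (G w')" "\<omega> \<in> \<Omega>"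
  shows "relabel w x (relabel w' x' \<omega>) = relabel w' x' (relabel w x \<omega>)"
proof -
  note ww = edge_verts[OF assms(1)]
  have eq: "\<iota> w x \<otimes>\<^bsub>P\<^esub> \<iota> w' x' = \<iota> w' x' \<otimes>\<^bsub>P\<^esub> \<iota> w x" using incl_commute assms by blast
  have "\<iota> w x \<otimes>\<^bsub>P\<^esub> (\<iota> w' x' \<otimes>\<^bsub>P\<^esub> p \<otimes>\<^bsub>P\<^esub> inv\<^bsub>P\<^esub> \<iota> w' x') \<otimes>\<^bsub>P\<^esub> inv\<^bsub>P\<^esub> \<iota> w x
      = \<iota> w' x' \<otimes>\<^bsub>P\<^esub> (\<iota> w x \<otimes>\<^bsub>P\<^esub> p \<otimes>\<^bsub>P\<^esub> inv\<^bsub>P\<^esub> \<iota> w x) \<otimes>\<^bsub>P\<^esub> inv\<^bsub>P\<^esub> \<iota> w' x'"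
    (is "?l = ?r") if "p \<in> carrier P" for p
  proof -
    have "?l = (\<iota> w x \<otimes>\<^bsub>P\<^esub> \<iota> w' x') \<otimes>\<^bsub>P\<^esub> p \<otimes>\<^bsub>P\<^esub> inv\<^bsub>P\<^esub> (\<iota> w x \<otimes>\<^bsub>P\<^esub> \<iota> w' x')"
      using ww assms that by (simp add: P.m_assoc P.inv_mult_group)
    also have "\<dots> = ?r"
      unfolding eq using ww assms that by (simp add: P.m_assoc P.inv_mult_group)
    finally show ?thesis .
  qed
  then show ?thesis using assms edge_neq[OF assms(1)] by (auto simp: relabel_def \<Omega>_def)
qed

text \<open>A neighbour of \<open>v\<close> centralises the image of \<open>G v\<close>, so the
  embedding is unchanged. The second component is unchanged as well, because \<open>u\<close> is not
  adjacent to \<open>v\<close> and hence differs from \<open>w\<close>.\<close>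

lemma relabel_fixes_\<omega>0:
  assumes "{v, w} \<in> edges \<Gamma>" "x \<in> carrier (G w)"
  shows "relabel w x \<omega>0 = \<omega>0"
proof -
  have w: "w \<in> verts \<Gamma>" "w \<noteq> u" using edge_verts[OF assms(1)] assms(1) uv by (auto simp: insert_commute)
  have "\<iota> w x \<otimes>\<^bsub>P\<^esub> \<iota> v a \<otimes>\<^bsub>P\<^esub> inv\<^bsub>P\<^esub> \<iota> w x = \<iota> v a" if "a \<in> carrier (G v)" for a
    using incl_commute[OF assms(1) that assms(2)] w v assms that
    by (metis P.inv_solve_right' P.m_closed incl_closed)
  then show ?thesis using w assms(2) by (auto simp: relabel_def \<omega>0_def fun_eq_iff)
qed

lemma vertex_act_closed:
  "\<lbrakk>w \<in> verts \<Gamma>; x \<in> carrier (G w); t \<in> R\<rbrakk> \<Longrightarrow> vertex_act w x t \<in> R"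
  by (auto simp: vertex_act_def map_reduced_words relabel_closed relabel_inj intro!: Gv.letter_act_closed \<omega>0_mem)

lemma letters: "\<lbrakk>t \<in> R; p \<in> set t\<rbrakk> \<Longrightarrow> fst p \<in> \<Omega> \<and> snd p \<in> carrier (G v)"
  by (auto simp: reduced_words_def)

lemma vertex_act_hom:
  assumes w: "w \<in> verts \<Gamma>"
  shows "(\<lambda>x. \<lambda>t\<in>R. vertex_act w x t) \<in> hom (G w) (BijGroup R)"
proof (rule group_action_hom)
  show "vertex_act w \<one>\<^bsub>G w\<^esub> t = t" if "t \<in> R" for t
    using that w letters[OF that]
    by (auto simp: vertex_act_def Gv.letter_act_one[where \<Omega> = \<Omega>] relabel_one intro!: map_idI prod_eqI)
  show "vertex_act w (x \<otimes>\<^bsub>G w\<^esub> y) t = vertex_act w x (vertex_act w y t)"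
    if "x \<in> carrier (G w)" "y \<in> carrier (G w)" "t \<in> R" for x y t
    using that w letters[OF that(3)]
    by (auto simp: vertex_act_def Gv.letter_act_mult[where \<Omega> = \<Omega>] relabel_mult)
qed (use w vertex_group vertex_act_closed in auto)

text \<open>On an edge at \<open>v\<close>, the renaming fixes the distinguished factor and so
  commutes with the letter action there. On all other edges both actions are renamings, which
  commute letter by letter.\<close>

lemma vertex_act_commute:
  assumes "{w, w'} \<in> edges \<Gamma>" "x \<in> carrier (G w)" "x' \<in> carrier (G w')" "t \<in> R"
  shows "vertex_act w x (vertex_act w' x' t) = vertex_act w' x' (vertex_act w x t)"
proof -
  have vcase: "vertex_act v x (vertex_act w x' t) = vertex_act w x' (vertex_act v x t)"
    if e: "{v, w} \<in> edges \<Gamma>" and "x \<in> carrier (G v)" "x' \<in> carrier (G w)" for w x x'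
    using that edge_neq[OF e] edge_verts[OF e] assms(4)
    by (simp add: vertex_act_def letter_act_map[OF relabel_inj \<omega>0_mem] relabel_fixes_\<omega>0)
  consider "w = v" | "w' = v" | "w \<noteq> v" "w' \<noteq> v" by blast
  then show ?thesis
  proof cases
    case 1 then show ?thesis using vcase assms by blast
  next
    case 2 then show ?thesis using vcase[of w x' x] assms by (simp add: insert_commute)
  next
    case 3
    have "relabel w x (relabel w' x' (fst p)) = relabel w' x' (relabel w x (fst p))" if "p \<in> set t" for p
      using relabel_commute[OF assms(1-3)] letters[OF assms(4) that] by blast
    with 3 show ?thesis by (auto simp: vertex_act_def apfst_def map_prod_def case_prod_beta)
  qed
qed

section \<open>Comparing the action on reduced words with multiplication in the graph
  product\<close>

definition word_product where "word_product = word_eval P fst"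

lemma word_product_simps [simp]:
  "word_product [] = \<one>\<^bsub>P\<^esub>"
  "word_product (p # t) = fst (fst p) (snd p) \<otimes>\<^bsub>P\<^esub> word_product t"
  by (simp_all add: word_product_def)

lemma word_product_closed [simp]: "t \<in> R \<Longrightarrow> word_product t \<in> carrier P"
  unfolding word_product_def by (rule P.word_eval_closed) (drule (1) letters, auto simp: \<Omega>_def)

text \<open>Dropping a trivial syllable does not alter the product, since \<open>\<iota> v\<close>
  maps the identity to the identity. So \<open>push\<close> always multiplies by its syllable from
  the left.\<close>

lemma word_product_letter_act:
  assumes x: "x \<in> carrier (G v)" and t: "t \<in> R"
  shows "word_product (letter_act (G v) \<omega>0 x t) = \<iota> v x \<otimes>\<^bsub>P\<^esub> word_product t"
proof -
  have push: "word_product (push (G v) \<omega>0 a s) = \<iota> v a \<otimes>\<^bsub>P\<^esub> word_product s" if "a \<in> carrier (G v)" "s \<in> R" for a s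
    using that v by (auto simp: push_def \<omega>0_def incl_one)
  let ?a = "head_at (G v) \<omega>0 t" and ?s = "tail_at \<omega>0 t"
  have as: "?a \<in> carrier (G v)" "?s \<in> R" using t by simp_all
  have "word_product t = \<iota> v ?a \<otimes>\<^bsub>P\<^esub> word_product ?s"
    using push[OF as] Gv.push_head_tail[OF t] by simp
  then show ?thesis
    using x v as by (simp add: letter_act_def push incl_mult P.m_assoc)
qed

text \<open>Renaming conjugates the value of every letter, and the inner conjugating factors
  cancel.\<close>

lemma word_product_map:
  assumes w: "w \<in> verts \<Gamma>" and x: "x \<in> carrier (G w)" and t: "t \<in> R"
  shows "word_product (map (apfst (relabel w x)) t) = \<iota> w x \<otimes>\<^bsub>P\<^esub> word_product t \<otimes>\<^bsub>P\<^esub> inv\<^bsub>P\<^esub> \<iota> w x"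
  using t
proof (induction t)
  case Nil
  then show ?case using w x by simp
next
  case (Cons p t)
  let ?k = "\<iota> w x" and ?c = "fst (fst p) (snd p)"
  have t: "t \<in> R" and c: "?c \<in> carrier P"
    using Cons.prems by (auto simp: reduced_words_Cons \<Omega>_def)
  have "word_product (map (apfst (relabel w x)) (p # t))
      = ?k \<otimes>\<^bsub>P\<^esub> ?c \<otimes>\<^bsub>P\<^esub> inv\<^bsub>P\<^esub> ?k \<otimes>\<^bsub>P\<^esub> (?k \<otimes>\<^bsub>P\<^esub> word_product t \<otimes>\<^bsub>P\<^esub> inv\<^bsub>P\<^esub> ?k)"
    using Cons.IH[OF t] by (simp add: relabel_def[of w x, THEN fun_cong, of "fst p"] case_prod_beta)
  also have "\<dots> = ?k \<otimes>\<^bsub>P\<^esub> (?c \<otimes>\<^bsub>P\<^esub> word_product t) \<otimes>\<^bsub>P\<^esub> inv\<^bsub>P\<^esub> ?k"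
    using w x t c by (simp add: P.m_assoc P.inv_mult_cancel)
  finally show ?case by simp
qed

lemma centre_fixed_by_retraction:
  assumes z: "z \<in> centre P" and nontriv: "carrier (G u) \<noteq> {\<one>\<^bsub>G u\<^esub>}"
    and \<rho>: "\<rho> \<in> hom P P"
    "\<And>w x. \<lbrakk>w \<in> verts \<Gamma>; x \<in> carrier (G w)\<rbrakk> \<Longrightarrow> \<rho> (\<iota> w x) = (if w = v then \<one>\<^bsub>P\<^esub> else \<iota> w x)"
  shows "\<rho> z = z"
proof -
  interpret \<rho>: group_hom P P \<rho> by unfold_locales (rule \<rho>(1))
  let ?B = "BijGroup R" and ?f = "\<lambda>w x. \<lambda>t\<in>R. vertex_act w x t"
  have f: "?f w x \<in> carrier ?B" if "w \<in> verts \<Gamma>" "x \<in> carrier (G w)" for w x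
    using vertex_act_hom[OF that(1)] that(2) by (rule hom_in_carrier)
  obtain \<Theta> where \<Theta>: "\<Theta> \<in> hom P ?B"
    and \<Theta>\<iota>: "\<And>w x. \<lbrakk>w \<in> verts \<Gamma>; x \<in> carrier (G w)\<rbrakk> \<Longrightarrow> \<Theta> (\<iota> w x) = ?f w x"
  proof (rule graph_product_lift[of ?B ?f])
    show "?f w x \<otimes>\<^bsub>?B\<^esub> ?f w' x' = ?f w' x' \<otimes>\<^bsub>?B\<^esub> ?f w x"
      if "{w, w'} \<in> edges \<Gamma>" "x \<in> carrier (G w)" "x' \<in> carrier (G w')" for w w' x x'
    proof -
      interpret B: group ?B by (rule group_BijGroup)
      note ww = edge_verts[OF that(1)]
      note ff = f[OF conjunct1[OF ww] that(2)] f[OF conjunct2[OF ww] that(3)]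
      show ?thesis
        by (rule BijGroup_eqI[of _ R])
          (use ww that ff in \<open>simp_all add: BijGroup_mult_apply vertex_act_closed vertex_act_commute del: restrict_apply\<close>,
           use ww that in \<open>simp add: vertex_act_closed vertex_act_commute\<close>)
    qed
  qed (use vertex_act_hom group_BijGroup in auto)
  interpret \<Theta>: group_hom P ?B \<Theta>
    by (intro group_hom.intro group_hom_axioms.intro P.is_group group_BijGroup \<Theta>)
  have \<Theta>_mult: "\<Theta> (p \<otimes>\<^bsub>P\<^esub> q) t = \<Theta> p (\<Theta> q t)" if "p \<in> carrier P" "q \<in> carrier P" "t \<in> R" for p q t
    using that by (simp add: BijGroup_mult_apply)
  have \<Theta>_closed: "\<Theta> p t \<in> R" if "p \<in> carrier P" "t \<in> R" for p t
    using \<Theta>.hom_closed[OF that(1)] that(2) by (auto simp: BijGroup_def dest: Bij_imp_funcset)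
  \<comment> \<open>One formula covers both kinds of letters: for \<open>w = v\<close> the letter
    multiplies from the left and \<open>\<rho>\<close> kills it; otherwise it conjugates and
    \<open>\<rho>\<close> fixes it.\<close>
  have gen: "word_product (\<Theta> (\<iota> w x) t) = \<iota> w x \<otimes>\<^bsub>P\<^esub> word_product t \<otimes>\<^bsub>P\<^esub> inv\<^bsub>P\<^esub> \<rho> (\<iota> w x)"
    if "w \<in> verts \<Gamma>" "x \<in> carrier (G w)" "t \<in> R" for w x t
    using that by (auto simp: \<Theta>\<iota> \<rho>(2) vertex_act_def word_product_letter_act word_product_map)
  have equivariant: "word_product (\<Theta> p t) = p \<otimes>\<^bsub>P\<^esub> word_product t \<otimes>\<^bsub>P\<^esub> inv\<^bsub>P\<^esub> \<rho> p" if p: "p \<in> carrier P" and t: "t \<in> R" for p t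
    using p
  proof (induction rule: graph_product_induct)
    case one
    have "\<Theta> \<one>\<^bsub>P\<^esub> t = t" using t by (simp only: \<Theta>.hom_one) (simp add: BijGroup_def)
    then show ?case using t by simp
  next
    case (incl w x p)
    let ?k = "\<iota> w x"
    have "word_product (\<Theta> (?k \<otimes>\<^bsub>P\<^esub> p) t) = ?k \<otimes>\<^bsub>P\<^esub> (p \<otimes>\<^bsub>P\<^esub> word_product t \<otimes>\<^bsub>P\<^esub> inv\<^bsub>P\<^esub> \<rho> p) \<otimes>\<^bsub>P\<^esub> inv\<^bsub>P\<^esub> \<rho> ?k"
      using incl t by (simp add: \<Theta>_mult \<Theta>_closed gen del: \<Theta>.hom_mult)
    also have "\<dots> = ?k \<otimes>\<^bsub>P\<^esub> p \<otimes>\<^bsub>P\<^esub> word_product t \<otimes>\<^bsub>P\<^esub> inv\<^bsub>P\<^esub> \<rho> (?k \<otimes>\<^bsub>P\<^esub> p)"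
      using incl t by (simp add: P.m_assoc P.inv_mult_group)
    finally show ?case .
  qed
  obtain x where x: "x \<in> carrier (G u)" "x \<noteq> \<one>\<^bsub>G u\<^esub>" using nontriv Gu.one_closed by blast
  have zc: "z \<in> carrier P" using z by (simp add: centre_def)
  have kc: "\<iota> u x \<in> carrier P" using u x by blast
  have \<Theta>u: "\<Theta> (\<iota> u x) t = map (apfst (relabel u x)) t" if "t \<in> R" for t
    using that u x uv by (simp add: \<Theta>\<iota> vertex_act_def)
  have "\<Theta> (\<iota> u x) (\<Theta> z []) = \<Theta> (\<iota> u x \<otimes>\<^bsub>P\<^esub> z) []" using zc kc by (subst \<Theta>_mult) simp_all
  also have "\<iota> u x \<otimes>\<^bsub>P\<^esub> z = z \<otimes>\<^bsub>P\<^esub> \<iota> u x" using z kc by (simp add: centre_def)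
  \<comment> \<open>The empty word has no names to change, so the letter \<open>\<iota> u x\<close>
    fixes it.\<close>
  also have "\<Theta> (z \<otimes>\<^bsub>P\<^esub> \<iota> u x) [] = \<Theta> z []" using zc kc by (subst \<Theta>_mult) (simp_all add: \<Theta>u)
  finally have fixed: "map (apfst (relabel u x)) (\<Theta> z []) = \<Theta> z []"
    using \<Theta>u \<Theta>_closed[OF zc, of "[]"] by simp
  \<comment> \<open>In a non-empty fixed word, the \<open>G u\<close>-component \<open>y\<close> of
    the first name would satisfy \<open>x y = y\<close>, against the choice of
    \<open>x\<close>.\<close>
  have "\<Theta> z [] = []"
  proof (rule ccontr)
    assume "\<Theta> z [] \<noteq> []"
    then obtain c y a t where ct: "\<Theta> z [] = ((c, y), a) # t" by (metis list.exhaust surj_pair)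
    have y: "y \<in> carrier (G u)"
      using \<Theta>_closed[OF zc, of "[]"] by (simp add: ct reduced_words_Cons \<Omega>_def)
    have "x \<otimes>\<^bsub>G u\<^esub> y = y" using fixed by (simp add: ct relabel_def)
    then show False using x y by simp
  qed
  then have "z \<otimes>\<^bsub>P\<^esub> inv\<^bsub>P\<^esub> \<rho> z = \<one>\<^bsub>P\<^esub>" using equivariant[OF zc, of "[]"] zc by simp
  then show ?thesis using zc by (metis P.inv_closed P.inv_equality P.inv_inv \<rho>.hom_closed)
qed

end

text \<open>Each retraction killing a single vertex fixes a central element. Composing them over all
  vertices gives the trivial homomorphism, which must then fix the element too.\<close>

lemma (in graph_of_groups) centre_trivial:
  assumes nontriv: "\<And>v. v \<in> verts \<Gamma> \<Longrightarrow> carrier (G v) \<noteq> {\<one>\<^bsub>G v\<^esub>}"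
    and no_cone: "\<And>v. v \<in> verts \<Gamma> \<Longrightarrow> star \<Gamma> v \<noteq> verts \<Gamma>"
  shows "centre P \<subseteq> {\<one>\<^bsub>P\<^esub>}"
proof
  fix z assume z: "z \<in> centre P"
  then have zc: "z \<in> carrier P" by (simp add: centre_def)
  have fixed: "\<rho> z = z"
    if "finite S" "S \<subseteq> verts \<Gamma>" "\<rho> \<in> hom P P"
      "\<And>w x. \<lbrakk>w \<in> verts \<Gamma>; x \<in> carrier (G w)\<rbrakk> \<Longrightarrow> \<rho> (\<iota> w x) = (if w \<in> S then \<one>\<^bsub>P\<^esub> else \<iota> w x)"
    for S \<rho>
    using that
  proof (induction S arbitrary: \<rho> rule: finite_induct)
    case empty
    have "\<rho> z = id z"
      by (rule graph_product_hom_eq[OF P.is_group empty(2) _ zc]) (use empty(3) in \<open>auto simp: hom_def\<close>)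
    then show ?case by simp
  next
    case (insert v S)
    have v: "v \<in> verts \<Gamma>" using insert.prems by simp
    obtain u where u: "u \<in> verts \<Gamma>" "u \<noteq> v" "{v, u} \<notin> edges \<Gamma>"
      using no_cone[OF v] v by (auto simp: star_def)
    interpret nonadjacent \<Gamma> G u v
      by unfold_locales (use u v in \<open>auto simp: insert_commute\<close>)
    obtain \<rho>1 where \<rho>1: "\<rho>1 \<in> hom P P" "\<And>w x. \<lbrakk>w \<in> verts \<Gamma>; x \<in> carrier (G w)\<rbrakk>
        \<Longrightarrow> \<rho>1 (\<iota> w x) = (if w \<in> {v} then \<one>\<^bsub>P\<^esub> else \<iota> w x)"
      by (rule retraction[of "{v}"]) (rule that)
    obtain \<rho>2 where \<rho>2: "\<rho>2 \<in> hom P P" "\<And>w x. \<lbrakk>w \<in> verts \<Gamma>; x \<in> carrier (G w)\<rbrakk>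
        \<Longrightarrow> \<rho>2 (\<iota> w x) = (if w \<in> S then \<one>\<^bsub>P\<^esub> else \<iota> w x)"
      by (rule retraction[of S]) (rule that)
    interpret \<rho>2: group_hom P P \<rho>2 by unfold_locales (rule \<rho>2(1))
    \<comment> \<open>Killing \<open>insert v S\<close> is the same as killing \<open>v\<close>
      first and then \<open>S\<close>, since the two maps agree on letters.\<close>
    have "\<rho> z = (\<rho>2 \<circ> \<rho>1) z"
      by (rule graph_product_hom_eq[OF P.is_group insert.prems(2) hom_compose[OF \<rho>1(1) \<rho>2(1)] zc])
        (auto simp: insert.prems(3) \<rho>1(2) \<rho>2(2))
    also have "\<rho>1 z = z"
      using centre_fixed_by_retraction[OF z nontriv[OF u(1)] \<rho>1(1)] \<rho>1(2) by simp
    then have "(\<rho>2 \<circ> \<rho>1) z = z" using insert.IH[OF _ \<rho>2] insert.prems by simp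
    finally show ?case .
  qed
  obtain \<rho> where \<rho>: "\<rho> \<in> hom P P" "\<And>w x. \<lbrakk>w \<in> verts \<Gamma>; x \<in> carrier (G w)\<rbrakk>
      \<Longrightarrow> \<rho> (\<iota> w x) = (if w \<in> verts \<Gamma> then \<one>\<^bsub>P\<^esub> else \<iota> w x)"
    by (rule retraction[of "verts \<Gamma>"]) (rule that)
  have "\<rho> z = (\<lambda>_. \<one>\<^bsub>P\<^esub>) z"
    by (rule graph_product_hom_eq[OF P.is_group \<rho>(1) _ zc]) (auto simp: hom_def \<rho>(2))
  moreover have "\<rho> z = z"
    using fixed[OF _ _ \<rho>] simple by (simp add: simple_graph_def)
  ultimately show "z \<in> {\<one>\<^bsub>P\<^esub>}" by simp
qed

section \<open>Semicompleteness of central extensions that split\<close>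

lemma (in group) hom_derived:
  assumes "group H" "h \<in> hom G H" "x \<in> derived G (carrier G)"
  shows "h x \<in> derived H (carrier H)"
proof -
  interpret h: group_hom G H h
    using assms by (simp add: group_hom_def group_hom_axioms_def is_group)
  have "h x \<in> derived H (h ` carrier G)"
    using h.derived_img[of "carrier G"] assms(3) by simp
  then show ?thesis
    using h.H.mono_derived[of "h ` carrier G" "carrier H"] h.hom_closed by blast
qed

lemma (in group) hom_abelian_derived:
  assumes "comm_group H" "h \<in> hom G H" "x \<in> derived G (carrier G)"
  shows "h x = \<one>\<^bsub>H\<^esub>"
proof -
  interpret H: comm_group H by fact
  show ?thesis
    using hom_derived[OF H.is_group assms(2,3)] H.derived_eq_singleton[of "carrier H"] by simp
qed

text \<open>An automorphism acts trivially on the abelianization exactly if it maps every coset of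
  the derived subgroup to itself; this is tested on coset representatives.\<close>

lemma (in group) IA_iff:
  "\<phi> \<in> IA G \<longleftrightarrow> \<phi> \<in> auto G \<and> (\<forall>x\<in>carrier G. \<phi> x \<otimes> inv x \<in> derived G (carrier G))"
proof -
  let ?D = "derived G (carrier G)"
  have D: "subgroup ?D G" by (simp add: derived_is_subgroup)
  have *: "ab_map G \<phi> = \<one>\<^bsub>AutoGroup (abelianization G)\<^esub>
      \<longleftrightarrow> (\<forall>x\<in>carrier G. \<phi> x \<otimes> inv x \<in> ?D)" if \<phi>: "\<phi> \<in> auto G"
  proof -
    have c: "\<phi> x \<in> carrier G" if "x \<in> carrier G" for x
      using \<phi> that by (auto simp: auto_def hom_def)
    have "ab_map G \<phi> = \<one>\<^bsub>AutoGroup (abelianization G)\<^esub>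
      \<longleftrightarrow> (\<forall>A\<in>carrier (abelianization G). ab_map G \<phi> A = A)"
      by (auto simp: AutoGroup_def BijGroup_def ab_map_def fun_eq_iff)
    also have "\<dots> \<longleftrightarrow> (\<forall>x\<in>carrier G. ?D #> \<phi> x = ?D #> x)"
      using ab_map_coset[OF \<phi>] by (simp add: abelianization_def carrier_FactGroup)
    also have "\<dots> \<longleftrightarrow> (\<forall>x\<in>carrier G. \<phi> x \<otimes> inv x \<in> ?D)"
    proof (rule ball_cong[OF HOL.refl], rule iffI)
      fix x assume x: "x \<in> carrier G"
      show "\<phi> x \<otimes> inv x \<in> ?D" if "?D #> \<phi> x = ?D #> x"
      proof -
        have "\<phi> x \<in> ?D #> x" using rcos_self[OF c[OF x] D] that by simp
        then obtain d where d: "d \<in> ?D" "\<phi> x = d \<otimes> x" by (auto simp: r_coset_def)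
        then show ?thesis using x subgroup.mem_carrier[OF D] by (simp add: m_assoc)
      qed
      show "?D #> \<phi> x = ?D #> x" if "\<phi> x \<otimes> inv x \<in> ?D"
      proof -
        have "(\<phi> x \<otimes> inv x) \<otimes> x \<in> ?D #> x" using that by (auto simp: r_coset_def)
        then have "\<phi> x \<in> ?D #> x" using x c by (simp add: m_assoc)
        then show ?thesis using repr_independence[OF _ x D] by simp
      qed
    qed
    finally show ?thesis .
  qed
  then show ?thesis
    by (auto simp: IA_def kernel_def AutoGroup_def)
qed

lemma (in group) Inn_subset_IA: "Inn G \<subseteq> IA G"
proof
  fix \<phi> assume "\<phi> \<in> Inn G"
  then obtain g where g: "g \<in> carrier G" and \<phi>: "\<phi> = (\<lambda>x\<in>carrier G. g \<otimes> x \<otimes> inv g)"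
    by (auto simp: Inn_def)
  have "\<phi> \<in> hom G G"
    using g by (auto simp: \<phi> hom_def m_assoc inv_mult_cancel)
  moreover have "bij_betw \<phi> (carrier G) (carrier G)"
    by (rule bij_betw_byWitness[where f' = "\<lambda>x. inv g \<otimes> x \<otimes> g"])
      (use g in \<open>auto simp: \<phi> m_assoc inv_mult_cancel\<close>)
  ultimately have "\<phi> \<in> auto G" by (auto simp: auto_def Bij_def \<phi>)
  \<comment> \<open>This element is the commutator of \<open>g\<close> and \<open>x\<close>.\<close>
  moreover have "\<phi> x \<otimes> inv x \<in> derived G (carrier G)" if "x \<in> carrier G" for x
    using that g unfolding derived_def by (auto simp: \<phi> intro!: generate.incl)
  ultimately show "\<phi> \<in> IA G" by (simp add: IA_iff)
qed

lemma (in group) semicomplete_iff: "semicomplete G \<longleftrightarrow> IA G \<subseteq> Inn G"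
  using Inn_subset_IA by (auto simp: semicomplete_def)

section \<open>Groups that split over a central kernel\<close>

locale central_split =
  P: group P + Q: group Q for P :: "('p, 'm) monoid_scheme" and Q :: "('q, 'n) monoid_scheme" +
  fixes r :: "'p \<Rightarrow> 'q" and i :: "'q \<Rightarrow> 'p"
  assumes r_hom: "r \<in> hom P Q" and i_hom: "i \<in> hom Q P"
    and ri: "q \<in> carrier Q \<Longrightarrow> r (i q) = q"
    and kernel_central: "kernel P Q r \<subseteq> centre P"
begin

sublocale r: group_hom P Q r by unfold_locales (rule r_hom)
sublocale i: group_hom Q P i by unfold_locales (rule i_hom)

text \<open>The projection of \<open>P\<close> onto the central kernel of \<open>r\<close> along the
  image of \<open>i\<close>, so that \<open>central_part\<close> and \<open>r\<close> are the two
  coordinates of a direct product.\<close>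

definition central_part where "central_part p = p \<otimes>\<^bsub>P\<^esub> inv\<^bsub>P\<^esub> i (r p)"

lemma central_part_closed [simp]: "p \<in> carrier P \<Longrightarrow> central_part p \<in> carrier P"
  by (simp add: central_part_def)

lemma r_central_part [simp]: "p \<in> carrier P \<Longrightarrow> r (central_part p) = \<one>\<^bsub>Q\<^esub>"
  by (simp add: central_part_def ri)

lemma central_part_i [simp]: "q \<in> carrier Q \<Longrightarrow> central_part (i q) = \<one>\<^bsub>P\<^esub>"
  by (simp add: central_part_def ri)

lemma decomp: "p \<in> carrier P \<Longrightarrow> p = central_part p \<otimes>\<^bsub>P\<^esub> i (r p)"
  by (simp add: central_part_def P.m_assoc)

lemma central_part_central: "\<lbrakk>p \<in> carrier P; x \<in> carrier P\<rbrakk> \<Longrightarrow> central_part p \<otimes>\<^bsub>P\<^esub> x = x \<otimes>\<^bsub>P\<^esub> central_part p"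
  using kernel_central subsetD[of "kernel P Q r" "centre P" "central_part p"] by (simp add: kernel_def centre_def)

lemma central_part_eq_self: "\<lbrakk>p \<in> carrier P; r p = \<one>\<^bsub>Q\<^esub>\<rbrakk> \<Longrightarrow> central_part p = p"
  by (simp add: central_part_def)

text \<open>The central part of the second factor can be moved past the inverse of
  \<open>i (r p)\<close>.\<close>

lemma central_part_mult:
  assumes "p \<in> carrier P" "p' \<in> carrier P"
  shows "central_part (p \<otimes>\<^bsub>P\<^esub> p') = central_part p \<otimes>\<^bsub>P\<^esub> central_part p'"
proof -
  have "central_part (p \<otimes>\<^bsub>P\<^esub> p') = p \<otimes>\<^bsub>P\<^esub> (central_part p' \<otimes>\<^bsub>P\<^esub> inv\<^bsub>P\<^esub> i (r p))"
    using assms by (simp add: central_part_def P.inv_mult_group P.m_assoc)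
  also have "\<dots> = central_part p \<otimes>\<^bsub>P\<^esub> central_part p'"
    using assms central_part_central[of p' "inv\<^bsub>P\<^esub> i (r p)"] by (simp add: central_part_def[of p] P.m_assoc)
  finally show ?thesis .
qed

text \<open>By \<open>central_part_mult\<close>, \<open>central_part\<close> is a homomorphism into
  an abelian group, the kernel of \<open>r\<close>, so it kills the derived subgroup.\<close>

lemma central_part_derived:
  assumes "p \<in> derived P (carrier P)"
  shows "central_part p = \<one>\<^bsub>P\<^esub>"
proof -
  let ?A = "P\<lparr>carrier := kernel P Q r\<rparr>"
  have "comm_group ?A"
    using kernel_central
    by (intro group.group_comm_groupI P.subgroup_imp_group r.subgroup_kernel)
      (auto simp: centre_def kernel_def)
  moreover have "central_part \<in> hom P ?A"
    by (auto simp: hom_def kernel_def central_part_mult)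
  ultimately show ?thesis
    using P.hom_abelian_derived[OF _ _ assms] by fastforce
qed

text \<open>Derived elements have trivial central part, so they lie in the copy of \<open>Q\<close>
  and are determined by their image under \<open>r\<close>.\<close>

lemma derived_eq:
  assumes "p \<in> derived P (carrier P)"
  shows "p = i (r p)"
proof -
  have p: "p \<in> carrier P" using assms P.derived_in_carrier[of "carrier P"] by auto
  then show ?thesis using decomp[OF p] central_part_derived[OF assms] by simp
qed

text \<open>An element of \<open>IA Q\<close> is extended by the identity on the central kernel. If
  the extension is conjugation by \<open>g\<close>, the given automorphism is conjugation by
  \<open>r g\<close>.\<close>

lemma semicomplete_base:
  assumes P: "semicomplete P"
  shows "semicomplete Q"
  unfolding Q.semicomplete_iff
proof
  fix \<psi> assume "\<psi> \<in> IA Q"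
  then have \<psi>: "\<psi> \<in> auto Q"
    and D: "\<And>x. x \<in> carrier Q \<Longrightarrow> \<psi> x \<otimes>\<^bsub>Q\<^esub> inv\<^bsub>Q\<^esub> x \<in> derived Q (carrier Q)"
    by (auto simp: Q.IA_iff)
  have hom: "\<psi> \<in> hom Q Q" and bij: "bij_betw \<psi> (carrier Q) (carrier Q)"
    and ext: "\<psi> \<in> extensional (carrier Q)"
    using \<psi> by (auto simp: auto_def Bij_def)
  interpret \<psi>: group_hom Q Q \<psi> by unfold_locales (rule hom)
  define \<phi> where "\<phi> = (\<lambda>p\<in>carrier P. central_part p \<otimes>\<^bsub>P\<^esub> i (\<psi> (r p)))"
  have r\<phi>: "r (\<phi> p) = \<psi> (r p)" if "p \<in> carrier P" for p
    using that by (simp add: \<phi>_def ri)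
  have "\<phi> \<in> hom P P"
  proof (rule homI)
    fix x y assume xy: "x \<in> carrier P" "y \<in> carrier P"
    let ?a = "i (\<psi> (r x))" and ?b = "i (\<psi> (r y))"
    have "\<phi> (x \<otimes>\<^bsub>P\<^esub> y) = central_part x \<otimes>\<^bsub>P\<^esub> ((central_part y \<otimes>\<^bsub>P\<^esub> ?a) \<otimes>\<^bsub>P\<^esub> ?b)"
      using xy by (simp add: \<phi>_def central_part_mult P.m_assoc)
    also have "central_part y \<otimes>\<^bsub>P\<^esub> ?a = ?a \<otimes>\<^bsub>P\<^esub> central_part y" using xy by (intro central_part_central) simp_all
    finally show "\<phi> (x \<otimes>\<^bsub>P\<^esub> y) = \<phi> x \<otimes>\<^bsub>P\<^esub> \<phi> y" using xy by (simp add: \<phi>_def P.m_assoc)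
  qed (simp add: \<phi>_def)
  moreover have "bij_betw \<phi> (carrier P) (carrier P)"
  proof (rule bij_betw_byWitness)
    let ?\<psi>' = "inv_into (carrier Q) \<psi>"
    have inv: "?\<psi>' (\<psi> q) = q" "\<psi> (?\<psi>' q) = q" "?\<psi>' q \<in> carrier Q" if "q \<in> carrier Q" for q
      using that bij by (auto simp: bij_betw_def inv_into_into f_inv_into_f)
    \<comment> \<open>The inverse of \<open>\<phi>\<close> is the same extension, built from the
      inverse of \<open>\<psi>\<close>.\<close>
    let ?\<phi>' = "\<lambda>p. central_part p \<otimes>\<^bsub>P\<^esub> i (?\<psi>' (r p))"
    have ss: "central_part (central_part p) = central_part p" if "p \<in> carrier P" for p
      using that by (simp add: central_part_eq_self)
    show "\<forall>p\<in>carrier P. ?\<phi>' (\<phi> p) = p"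
      by (auto simp: \<phi>_def central_part_mult ss inv ri decomp[symmetric])
    show "\<forall>p\<in>carrier P. \<phi> (?\<phi>' p) = p"
      by (auto simp: \<phi>_def central_part_mult ss inv ri decomp[symmetric])
    show "\<phi> ` carrier P \<subseteq> carrier P" "?\<phi>' ` carrier P \<subseteq> carrier P"
      by (auto simp: \<phi>_def inv)
  qed
  ultimately have "\<phi> \<in> auto P" by (auto simp: auto_def Bij_def \<phi>_def)
  moreover have "\<phi> p \<otimes>\<^bsub>P\<^esub> inv\<^bsub>P\<^esub> p \<in> derived P (carrier P)" if p: "p \<in> carrier P" for p
  proof -
    \<comment> \<open>The central part of \<open>p\<close> cancels in the quotient of
      \<open>\<phi> p\<close> by \<open>p\<close>, which leaves the \<open>i\<close>-image of the
      derived element \<open>?q\<close>.\<close>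
    let ?q = "\<psi> (r p) \<otimes>\<^bsub>Q\<^esub> inv\<^bsub>Q\<^esub> r p"
    have "inv\<^bsub>P\<^esub> p = inv\<^bsub>P\<^esub> (central_part p \<otimes>\<^bsub>P\<^esub> i (r p))" using decomp[OF p] by simp
    then have "\<phi> p \<otimes>\<^bsub>P\<^esub> inv\<^bsub>P\<^esub> p = (central_part p \<otimes>\<^bsub>P\<^esub> i ?q) \<otimes>\<^bsub>P\<^esub> inv\<^bsub>P\<^esub> central_part p"
      using p by (simp add: \<phi>_def P.inv_mult_group P.m_assoc)
    also have "\<dots> = i ?q" using p by (simp add: central_part_central P.m_assoc)
    finally show ?thesis using Q.hom_derived[OF P.is_group i_hom D] p by simp
  qed
  ultimately have "\<phi> \<in> Inn P" using P P.IA_iff by (simp add: semicomplete_def)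
  then obtain g where g: "g \<in> carrier P" and \<phi>: "\<phi> = (\<lambda>x\<in>carrier P. g \<otimes>\<^bsub>P\<^esub> x \<otimes>\<^bsub>P\<^esub> inv\<^bsub>P\<^esub> g)"
    by (auto simp: Inn_def)
  have "\<psi> q = r g \<otimes>\<^bsub>Q\<^esub> q \<otimes>\<^bsub>Q\<^esub> inv\<^bsub>Q\<^esub> r g" if "q \<in> carrier Q" for q
  proof -
    have "\<psi> q = r (\<phi> (i q))" using r\<phi> that by (simp add: ri)
    then show ?thesis using that g by (simp add: \<phi> ri)
  qed
  then have "\<psi> = (\<lambda>q\<in>carrier Q. r g \<otimes>\<^bsub>Q\<^esub> q \<otimes>\<^bsub>Q\<^esub> inv\<^bsub>Q\<^esub> r g)"
    using ext by (intro extensionalityI[of _ "carrier Q"]) auto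
  then show "\<psi> \<in> Inn Q" using g by (auto simp: Inn_def)
qed

text \<open>An element of \<open>IA P\<close> is the identity on the central kernel and preserves
  the copy of \<open>Q\<close>. It is thus determined by an automorphism in \<open>IA Q\<close>, and
  a conjugating element for that one is transported back by \<open>i\<close>.\<close>

lemma semicomplete_total:
  assumes Q: "semicomplete Q" and centreless: "centre Q \<subseteq> {\<one>\<^bsub>Q\<^esub>}"
  shows "semicomplete P"
  unfolding P.semicomplete_iff
proof
  fix \<phi> assume "\<phi> \<in> IA P"
  then have \<phi>: "\<phi> \<in> auto P"
    and D: "\<And>x. x \<in> carrier P \<Longrightarrow> \<phi> x \<otimes>\<^bsub>P\<^esub> inv\<^bsub>P\<^esub> x \<in> derived P (carrier P)"
    by (auto simp: P.IA_iff)
  have hom: "\<phi> \<in> hom P P" and bij: "bij_betw \<phi> (carrier P) (carrier P)"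
    and ext: "\<phi> \<in> extensional (carrier P)"
    using \<phi> by (auto simp: auto_def Bij_def)
  interpret \<phi>: group_hom P P \<phi> by unfold_locales (rule hom)
  \<comment> \<open>Surjectivity of \<open>\<phi>\<close> makes \<open>\<phi> a\<close> commute with
    the copy of \<open>Q\<close>, so \<open>r (\<phi> a)\<close> is central in \<open>Q\<close> and
    hence trivial. The derived element measuring the difference of \<open>\<phi> a\<close> and
    \<open>a\<close> then has trivial image under \<open>r\<close>, and \<open>derived_eq\<close>
    makes it trivial.\<close>
  have fix_ker: "\<phi> a = a" if a: "a \<in> carrier P" and ra: "r a = \<one>\<^bsub>Q\<^esub>" for a
  proof -
    have "r (\<phi> a) \<otimes>\<^bsub>Q\<^esub> q = q \<otimes>\<^bsub>Q\<^esub> r (\<phi> a)" if q: "q \<in> carrier Q" for q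
    proof -
      obtain p where p: "p \<in> carrier P" "\<phi> p = i q"
        using bij q by (metis bij_betw_imp_surj_on i.hom_closed imageE)
      have "\<phi> a \<otimes>\<^bsub>P\<^esub> i q = i q \<otimes>\<^bsub>P\<^esub> \<phi> a"
        using central_part_central[OF a p(1)] a p ra \<phi>.hom_mult by (metis central_part_eq_self)
      then have "r (\<phi> a) \<otimes>\<^bsub>Q\<^esub> r (i q) = r (i q) \<otimes>\<^bsub>Q\<^esub> r (\<phi> a)"
        using a q by (metis \<phi>.hom_closed i.hom_closed r.hom_mult)
      then show ?thesis using q by (simp add: ri)
    qed
    then have "r (\<phi> a) \<in> centre Q" using a by (simp add: centre_def)
    then have "r (\<phi> a) = \<one>\<^bsub>Q\<^esub>" using centreless by auto
    then have "\<phi> a \<otimes>\<^bsub>P\<^esub> inv\<^bsub>P\<^esub> a = \<one>\<^bsub>P\<^esub>"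
      using derived_eq[OF D[OF a]] a ra by simp
    then show ?thesis using a by (metis P.inv_equality P.inv_inv \<phi>.hom_closed P.inv_closed)
  qed
  define \<psi> where "\<psi> = (\<lambda>q\<in>carrier Q. r (\<phi> (i q)))"
  \<comment> \<open>The quotient of \<open>\<phi> (i q)\<close> by \<open>i q\<close> is derived, so
    by \<open>derived_eq\<close> it lies in the copy of \<open>Q\<close>, and with it
    \<open>\<phi> (i q)\<close>.\<close>
  have \<phi>i: "\<phi> (i q) = i (\<psi> q)" if q: "q \<in> carrier Q" for q
  proof -
    have "\<phi> (i q) \<otimes>\<^bsub>P\<^esub> inv\<^bsub>P\<^esub> i q = i (\<psi> q) \<otimes>\<^bsub>P\<^esub> inv\<^bsub>P\<^esub> i q"
      using derived_eq[OF D, of "i q"] q by (simp add: \<psi>_def ri)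
    then show ?thesis using q by (simp add: \<psi>_def)
  qed
  have \<phi>_eq: "\<phi> p = central_part p \<otimes>\<^bsub>P\<^esub> i (\<psi> (r p))" if p: "p \<in> carrier P" for p
  proof -
    have "\<phi> p = \<phi> (central_part p \<otimes>\<^bsub>P\<^esub> i (r p))" using decomp[OF p] by simp
    then show ?thesis using p by (simp add: fix_ker \<phi>i)
  qed
  have "\<psi> \<in> hom Q Q" by (auto simp: hom_def \<psi>_def)
  moreover have "bij_betw \<psi> (carrier Q) (carrier Q)"
    unfolding bij_betw_def
  proof
    show "inj_on \<psi> (carrier Q)"
    proof (rule inj_onI)
      fix x y assume xy: "x \<in> carrier Q" "y \<in> carrier Q" "\<psi> x = \<psi> y"
      then have "\<phi> (i x) = \<phi> (i y)" by (simp add: \<phi>i)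
      then have "i x = i y" using bij xy by (auto simp: bij_betw_def inj_on_def)
      then show "x = y" using xy ri by metis
    qed
    show "\<psi> ` carrier Q = carrier Q"
    proof (intro equalityI subsetI)
      fix q assume q: "q \<in> carrier Q"
      obtain p where p: "p \<in> carrier P" "\<phi> p = i q"
        using bij q by (metis bij_betw_imp_surj_on i.hom_closed imageE)
      have "\<psi> (r p) \<in> carrier Q" using p by (simp add: \<psi>_def)
      then have "q = \<psi> (r p)"
        using arg_cong[OF \<phi>_eq[OF p(1)], of r] p q by (simp add: ri)
      then show "q \<in> \<psi> ` carrier Q" using p by auto
    qed (auto simp: \<psi>_def)
  qed
  ultimately have "\<psi> \<in> auto Q" by (auto simp: auto_def Bij_def \<psi>_def)
  moreover have "\<psi> q \<otimes>\<^bsub>Q\<^esub> inv\<^bsub>Q\<^esub> q \<in> derived Q (carrier Q)" if q: "q \<in> carrier Q" for q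
    using P.hom_derived[OF Q.is_group r_hom D[of "i q"]] q by (simp add: \<psi>_def ri)
  ultimately have "\<psi> \<in> Inn Q" using Q Q.IA_iff by (simp add: semicomplete_def)
  then obtain h where h: "h \<in> carrier Q" and \<psi>: "\<psi> = (\<lambda>q\<in>carrier Q. h \<otimes>\<^bsub>Q\<^esub> q \<otimes>\<^bsub>Q\<^esub> inv\<^bsub>Q\<^esub> h)"
    by (auto simp: Inn_def)
  \<comment> \<open>Conjugation by \<open>i h\<close> does not affect the central part and acts on
    the copy of \<open>Q\<close> as \<open>\<psi>\<close>.\<close>
  have "\<phi> p = i h \<otimes>\<^bsub>P\<^esub> p \<otimes>\<^bsub>P\<^esub> inv\<^bsub>P\<^esub> i h" if p: "p \<in> carrier P" for p
  proof -
    have "\<phi> p = (central_part p \<otimes>\<^bsub>P\<^esub> i h) \<otimes>\<^bsub>P\<^esub> (i (r p) \<otimes>\<^bsub>P\<^esub> inv\<^bsub>P\<^esub> i h)"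
      using p h by (simp add: \<phi>_eq \<psi> P.m_assoc)
    also have "central_part p \<otimes>\<^bsub>P\<^esub> i h = i h \<otimes>\<^bsub>P\<^esub> central_part p" using p h by (intro central_part_central) simp_all
    also have "i h \<otimes>\<^bsub>P\<^esub> central_part p \<otimes>\<^bsub>P\<^esub> (i (r p) \<otimes>\<^bsub>P\<^esub> inv\<^bsub>P\<^esub> i h)
        = i h \<otimes>\<^bsub>P\<^esub> (central_part p \<otimes>\<^bsub>P\<^esub> i (r p)) \<otimes>\<^bsub>P\<^esub> inv\<^bsub>P\<^esub> i h"
      using p h by (simp add: P.m_assoc)
    finally show ?thesis using decomp[OF p] by simp
  qed
  then have "\<phi> = (\<lambda>p\<in>carrier P. i h \<otimes>\<^bsub>P\<^esub> p \<otimes>\<^bsub>P\<^esub> inv\<^bsub>P\<^esub> i h)"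
    using ext by (intro extensionalityI[of _ "carrier P"]) auto
  then show "\<phi> \<in> Inn P" using h by (auto simp: Inn_def)
qed

end

section \<open>Splitting off the cone vertices\<close>

lemma (in graph_of_groups) cone_vertex_central:
  assumes v: "v \<in> verts \<Gamma>" "star \<Gamma> v = verts \<Gamma>" and comm: "comm_group (G v)" and a: "a \<in> carrier (G v)"
  shows "\<iota> v a \<in> centre P"
proof -
  interpret v: comm_group "G v" by (rule comm)
  have "\<iota> v a \<otimes>\<^bsub>P\<^esub> p = p \<otimes>\<^bsub>P\<^esub> \<iota> v a" if "p \<in> carrier P" for p
    using that
  proof (induction rule: graph_product_induct)
    case one
    then show ?case using v a by simp
  next
    case (incl w b p)
    \<comment> \<open>Letters at \<open>v\<close> commute because \<open>G v\<close> is abelian;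
      every other vertex is joined to \<open>v\<close> by an edge.\<close>
    have "\<iota> v a \<otimes>\<^bsub>P\<^esub> \<iota> w b = \<iota> w b \<otimes>\<^bsub>P\<^esub> \<iota> v a"
    proof (cases "w = v")
      case True
      then show ?thesis using incl a v v.m_comm by (simp flip: incl_mult)
    next
      case False
      then have "{v, w} \<in> edges \<Gamma>" using v incl(1) by (auto simp: star_def)
      then show ?thesis using incl_commute a incl(2) by blast
    qed
    moreover have "\<iota> v a \<in> carrier P" "\<iota> w b \<in> carrier P" using incl(1,2) v a by auto
    ultimately show ?case using incl(3,4) P.m_assoc by metis
  qed
  then show ?thesis using v a by (simp add: centre_def)
qed

lemma (in group) centre_mult: "\<lbrakk>x \<in> centre G; y \<in> centre G\<rbrakk> \<Longrightarrow> x \<otimes> y \<in> centre G"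
  unfolding centre_def using m_assoc m_closed by (smt (verit) mem_Collect_eq)

theorem propositionC:
  fixes \<Gamma> :: "'v sgraph"
    and G :: "'v \<Rightarrow> ('a, 'b) monoid_scheme"
    and \<Delta> :: "'v sgraph"
  assumes "simple_graph \<Gamma>" and "verts \<Gamma> \<noteq> {}"
    and "\<And>v. v \<in> verts \<Gamma> \<Longrightarrow> group (G v)"
    and "\<And>v. v \<in> verts \<Gamma> \<Longrightarrow> carrier (G v) \<noteq> {\<one>\<^bsub>G v\<^esub>}"
    and "\<Delta> = spanned \<Gamma> {v \<in> verts \<Gamma>. star \<Gamma> v = verts \<Gamma>}"
    and "\<And>v. v \<in> verts \<Delta> \<Longrightarrow> comm_group (G v)"
  shows "semicomplete (graph_product \<Gamma> G)
    \<longleftrightarrow> semicomplete (graph_product (spanned \<Gamma> (verts \<Gamma> - verts \<Delta>)) G)"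
proof -
  define W where "W = verts \<Gamma> - verts \<Delta>"
  let ?\<Gamma>' = "spanned \<Gamma> W"
  have verts': "verts ?\<Gamma>' = W" and edges': "edges ?\<Gamma>' = {e \<in> edges \<Gamma>. e \<subseteq> W}"
    by (simp_all add: spanned_def)
  have W: "v \<in> W \<longleftrightarrow> v \<in> verts \<Gamma> \<and> star \<Gamma> v \<noteq> verts \<Gamma>" for v
    by (auto simp: W_def assms(5) spanned_def)
  have \<Delta>: "verts \<Delta> = {v \<in> verts \<Gamma>. star \<Gamma> v = verts \<Gamma>}" by (simp add: assms(5) spanned_def)
  interpret P: graph_of_groups \<Gamma> G by (rule graph_of_groups.intro[OF assms(1,3)])
  interpret Q: graph_of_groups ?\<Gamma>' G
  proof (rule graph_of_groups.intro)
    have "finite W" using P.simple by (simp add: W_def simple_graph_def)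
    then show "simple_graph ?\<Gamma>'"
      using P.simple by (simp add: simple_graph_def verts' edges')
    show "group (G v)" if "v \<in> verts ?\<Gamma>'" for v
      using that assms(3) W by (simp add: verts')
  qed
  have inW: "v \<in> W" "v \<in> verts \<Gamma>" if "v \<in> verts ?\<Gamma>'" for v using that W by (auto simp: verts')
  obtain i where i: "i \<in> hom Q.P P.P"
    "\<And>v a. \<lbrakk>v \<in> verts ?\<Gamma>'; a \<in> carrier (G v)\<rbrakk> \<Longrightarrow> i (Q.\<iota> v a) = P.\<iota> v a"
  proof (rule Q.graph_product_lift[of P.P P.\<iota>])
    show "P.\<iota> v a \<otimes>\<^bsub>P.P\<^esub> P.\<iota> w b = P.\<iota> w b \<otimes>\<^bsub>P.P\<^esub> P.\<iota> v a"
      if "{v, w} \<in> edges ?\<Gamma>'" "a \<in> carrier (G v)" "b \<in> carrier (G w)" for v w a b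
      using that by (intro P.incl_commute) (auto simp: edges')
  qed (use inW P.incl_hom P.P.is_group in auto)
  \<comment> \<open>Cone vertices are sent to the identity, so the commutation condition only has
    content for edges inside \<open>W\<close>, which are edges of the spanned subgraph.\<close>
  let ?r = "\<lambda>v a. if v \<in> W then Q.\<iota> v a else \<one>\<^bsub>Q.P\<^esub>"
  obtain r where r: "r \<in> hom P.P Q.P"
    "\<And>v a. \<lbrakk>v \<in> verts \<Gamma>; a \<in> carrier (G v)\<rbrakk> \<Longrightarrow> r (P.\<iota> v a) = ?r v a"
  proof (rule P.graph_product_lift[of Q.P ?r])
    show "?r v \<in> hom (G v) Q.P" if "v \<in> verts \<Gamma>" for v
      using Q.incl_hom[of v] by (auto simp: verts' hom_def)
    show "?r v a \<otimes>\<^bsub>Q.P\<^esub> ?r w b = ?r w b \<otimes>\<^bsub>Q.P\<^esub> ?r v a"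
      if "{v, w} \<in> edges \<Gamma>" "a \<in> carrier (G v)" "b \<in> carrier (G w)" for v w a b
      using that Q.incl_commute[OF _ that(2,3)] by (simp add: edges' verts')
  qed (use Q.P.is_group in auto)
  interpret i: group_hom Q.P P.P i by unfold_locales (rule i(1))
  interpret r: group_hom P.P Q.P r by unfold_locales (rule r(1))
  have ri: "r (i q) = q" if "q \<in> carrier Q.P" for q
  proof -
    have "(r \<circ> i) q = id q"
      by (rule Q.graph_product_hom_eq[OF Q.P.is_group hom_compose[OF i(1) r(1)] _ that])
        (auto simp: hom_def i(2) r(2) inW)
    then show ?thesis by simp
  qed
  \<comment> \<open>A new letter in \<open>W\<close> conjugates the central element obtained so far,
    which changes nothing; a letter at a cone vertex contributes a central factor. For
    \<open>p\<close> in the kernel of \<open>r\<close> the expression is \<open>p\<close>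
    itself.\<close>
  have s_central: "p \<otimes>\<^bsub>P.P\<^esub> inv\<^bsub>P.P\<^esub> i (r p) \<in> centre P.P" if "p \<in> carrier P.P" for p
    using that
  proof (induction rule: P.graph_product_induct)
    case one
    then show ?case by (simp add: centre_def)
  next
    case (incl v a p)
    let ?k = "P.\<iota> v a" and ?c = "p \<otimes>\<^bsub>P.P\<^esub> inv\<^bsub>P.P\<^esub> i (r p)"
    have k: "?k \<in> carrier P.P" and c: "?c \<in> carrier P.P" using incl by auto
    have eq: "?k \<otimes>\<^bsub>P.P\<^esub> p \<otimes>\<^bsub>P.P\<^esub> inv\<^bsub>P.P\<^esub> i (r (?k \<otimes>\<^bsub>P.P\<^esub> p))
        = (?k \<otimes>\<^bsub>P.P\<^esub> ?c) \<otimes>\<^bsub>P.P\<^esub> inv\<^bsub>P.P\<^esub> i (r ?k)"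
      using incl k by (simp add: P.P.m_assoc P.P.inv_mult_group)
    show ?case
    proof (cases "v \<in> W")
      case True
      then have "i (r ?k) = ?k" using incl by (simp add: r(2) i(2) verts')
      moreover have "?k \<otimes>\<^bsub>P.P\<^esub> ?c = ?c \<otimes>\<^bsub>P.P\<^esub> ?k" using incl.IH k by (simp add: centre_def)
      ultimately show ?thesis unfolding eq using k c incl.IH by (simp add: P.P.m_assoc)
    next
      case False
      then have "?k \<in> centre P.P"
        using incl W assms(6) by (intro P.cone_vertex_central) (auto simp: \<Delta>)
      moreover have "i (r ?k) = \<one>\<^bsub>P.P\<^esub>" using False incl by (simp add: r(2))
      ultimately show ?thesis
        unfolding eq using k c incl.IH by (simp add: P.P.centre_mult)
    qed
  qed
  have kernel: "kernel P.P Q.P r \<subseteq> centre P.P"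
  proof
    fix p assume "p \<in> kernel P.P Q.P r"
    then show "p \<in> centre P.P" using s_central[of p] by (simp add: kernel_def)
  qed
  interpret central_split P.P Q.P r i
    by unfold_locales (use i(1) r(1) ri kernel in auto)
  \<comment> \<open>Removing the cone vertices creates no new ones: a vertex adjacent to all others
    in \<open>W\<close> is also adjacent to every removed vertex, so it would have been a cone
    vertex of \<open>\<Gamma>\<close>.\<close>
  have no_cone: "star ?\<Gamma>' v \<noteq> verts ?\<Gamma>'" if v: "v \<in> verts ?\<Gamma>'" for v
  proof
    assume cone: "star ?\<Gamma>' v = verts ?\<Gamma>'"
    have "w \<in> star \<Gamma> v" if w: "w \<in> verts \<Gamma>" for w
    proof (cases "w \<in> W")
      case True
      then have "w \<in> star ?\<Gamma>' v" using cone verts' by simp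
      then show ?thesis using w by (auto simp: star_def edges')
    next
      case False
      then have "v \<in> star \<Gamma> w" using W w inW[OF v] by blast
      then show ?thesis using w by (auto simp: star_def insert_commute)
    qed
    moreover have "star \<Gamma> v \<subseteq> verts \<Gamma>" using inW[OF v] by (auto simp: star_def)
    ultimately show False using W inW[OF v] by blast
  qed
  have "centre Q.P \<subseteq> {\<one>\<^bsub>Q.P\<^esub>}"
    by (rule Q.centre_trivial[OF assms(4) no_cone]) (use inW in auto)
  then show ?thesis
    using semicomplete_base semicomplete_total by (auto simp flip: W_def)
qed

end
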